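(* Let $\mu$ be a Borel measure on $M^*$ and let $\mathcal{H}=\int^\oplus_{M^*}\mathrm{d}\mu(p)\,H_p$ be a direct integral of separable Hilbert spaces $H_p$ with scalar products $\langle\cdot,\cdot\rangle_p$. Let $\Phi$ be a field on $\mathcal{H}$ with common dense domain $D$, and let $U$ be the representation of the translation group $M$ on $\mathcal{H}$ given by $(U(a)\varphi)(p)=e^{\mathrm{i}a\cdot p}\varphi(p)$. Suppose $\Phi$ is covariant under $U$, i.e. $U(a)D=D$ and $U(a)\Phi(f)U(a)^{-1}=\Phi(\{a\}f)$ on $D$ for all $a\in M$ and $f\in\mathcal{S}(M)$, where $(\{a\}f)(x)=f(x-a)$. Let $\Omega\in D$ satisfy $U(a)\Omega=\Omega$ for all $a\in M$. Then there are vectors $\Gamma(p)\in H_p$ such that $p\mapsto\Gamma(p)$ is weakly Borel and for every $f\in\mathcal{S}(M)$, \[ \big(\Phi(f)\Omega\big)(p)=\hat f(p)\,\Gamma(p) \] (as elements of $\mathcal{H}$, i.e. for $\mu$-almost all $p$).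
   Context: $M$ is four-dimensional Minkowski spacetime with Lorentz product $x\cdot y$ of signature $(-,+,+,+)$; $M^*$ is its dual, identified with $M$ via the Lorentz product, and $p\cdot x$ denotes the pairing. $\mathcal{S}(M)$ is the Schwartz space. The Fourier transform is $\hat f(p)=\int_M \mathrm{d}^4x\, e^{\mathrm{i}p\cdot x}f(x)$. Direct integral: the support of $\mu$ is partitioned into Borel sets $X_n$, $n=\omega,1,2,\dots$, with $H_p=\mathbb{C}^n$ for $p\in X_n$ ($n$ finite) and $H_p=\ell^2$ for $p\in X_\omega$; $\int^\oplus_{M^*}\mathrm{d}\mu(p)H_p$ is the Hilbert space of (equivalence classes, modulo $\mu$-a.e. equality) of functions $\varphi$ with $\varphi(p)\in H_p$, $p\mapsto\langle v,\varphi(p)\rangle_p$ measurable on each $X_n$ for every $v\in H_n$, and $\int\mathrm{d}\mu(p)\|\varphi(p)\|_p^2<\infty$, with scalar product $\langle\varphi,\psi\rangle=\int\mathrm{d}\mu(p)\langle\varphi(p),\psi(p)\rangle_p$. A map $p\mapsto u(p)\in H_p$ is weakly Borel if $p\mapsto\langle v,u(p)\rangle_p$ is Borel on each $X_n$ for every $v\in H_n$. A field on a Hilbert space $\mathcal{H}$ is an operator-valued distribution: a map $f\mapsto\Phi(f)$ assigning to each $f\in\mathcal{S}(M)$ a linear operator $\Phi(f)$, all defined on a common dense domain $D$, such that $f\mapsto\langle\varphi,\Phi(f)\psi\rangle$ is linear and continuous on $\mathcal{S}(M)$ for all $\varphi,\psi\in D$. *)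

theory Defs
  imports "HOL-Analysis.Analysis"
begin

type_synonym mink = "real^4"

text \<open>Lorentz product of signature (-,+,+,+); coordinate 1 is time.
  The dual space is identified with the space itself via this product.\<close>
definition lor :: "mink \<Rightarrow> mink \<Rightarrow> real" where
  "lor x y = - (x$1 * y$1) + x$2 * y$2 + x$3 * y$3 + x$4 * y$4"

definition pdiff :: "4 \<Rightarrow> (mink \<Rightarrow> complex) \<Rightarrow> mink \<Rightarrow> complex" where
  "pdiff i f x = vector_derivative (\<lambda>t::real. f (x + t *\<^sub>R axis i 1)) (at 0)"

fun pdiffs :: "4 list \<Rightarrow> (mink \<Rightarrow> complex) \<Rightarrow> mink \<Rightarrow> complex" where
  "pdiffs [] f = f"
| "pdiffs (i # is) f = pdiff i (pdiffs is f)"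

definition schwartz :: "(mink \<Rightarrow> complex) \<Rightarrow> bool" where
  "schwartz f \<longleftrightarrow>
     (\<forall>is. continuous_on UNIV (pdiffs is f) \<and>
        (\<forall>i x. ((\<lambda>t::real. pdiffs is f (x + t *\<^sub>R axis i 1))
                 has_vector_derivative pdiff i (pdiffs is f) x) (at 0))) \<and>
     (\<forall>is (m::nat). bounded (range (\<lambda>x. (1 + norm x) ^ m * norm (pdiffs is f x))))"

definition snorm :: "nat \<Rightarrow> 4 list \<Rightarrow> (mink \<Rightarrow> complex) \<Rightarrow> real" where
  "snorm m is f = (SUP x. (1 + norm x) ^ m * norm (pdiffs is f x))"

definition schwartz_tendsto :: "(nat \<Rightarrow> mink \<Rightarrow> complex) \<Rightarrow> (mink \<Rightarrow> complex) \<Rightarrow> bool" where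
  "schwartz_tendsto F f \<longleftrightarrow>
     (\<forall>m is. (\<lambda>k. snorm m is (\<lambda>x. F k x - f x)) \<longlonglongrightarrow> 0)"

text \<open>Linear and continuous functional on the Schwartz space (the space is
  metrizable, so continuity is sequential continuity).\<close>
definition schwartz_lin_cont :: "((mink \<Rightarrow> complex) \<Rightarrow> complex) \<Rightarrow> bool" where
  "schwartz_lin_cont T \<longleftrightarrow>
     (\<forall>f g a b. schwartz f \<longrightarrow> schwartz g \<longrightarrow>
        T (\<lambda>x. a * f x + b * g x) = a * T f + b * T g) \<and>
     (\<forall>F f. (\<forall>k. schwartz (F k)) \<longrightarrow> schwartz f \<longrightarrow> schwartz_tendsto F f \<longrightarrow>
        (\<lambda>k. T (F k)) \<longlonglongrightarrow> T f)"

definition translate :: "mink \<Rightarrow> (mink \<Rightarrow> complex) \<Rightarrow> mink \<Rightarrow> complex" where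
  "translate a f x = f (x - a)"

definition fourier :: "(mink \<Rightarrow> complex) \<Rightarrow> mink \<Rightarrow> complex" where
  "fourier f p = (\<integral>x. exp (\<i> * complex_of_real (lor p x)) * f x \<partial>lborel)"

text \<open>Fibre spaces: H_p is C^n (n finite) or l^2 (n = infinity), realised
  inside l^2(nat) as the square-summable sequences vanishing from index n on.\<close>
definition fib :: "enat \<Rightarrow> (nat \<Rightarrow> complex) set" where
  "fib n = {v. (\<forall>k. n \<le> enat k \<longrightarrow> v k = 0) \<and> summable (\<lambda>k. (cmod (v k))\<^sup>2)}"

definition l2inner :: "(nat \<Rightarrow> complex) \<Rightarrow> (nat \<Rightarrow> complex) \<Rightarrow> complex" where
  "l2inner v w = (\<Sum>k. cnj (v k) * w k)"

definition l2norm2 :: "(nat \<Rightarrow> complex) \<Rightarrow> real" where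
  "l2norm2 v = (\<Sum>k. (cmod (v k))\<^sup>2)"

text \<open>dimf p is the dimension of H_p; X_n = {p. dimf p = n}.\<close>
definition weakly_borel :: "(mink \<Rightarrow> enat) \<Rightarrow> (mink \<Rightarrow> nat \<Rightarrow> complex) \<Rightarrow> bool" where
  "weakly_borel dimf u \<longleftrightarrow>
     (\<forall>n. \<forall>v\<in>fib n. (\<lambda>p. l2inner v (u p))
        \<in> borel_measurable (restrict_space borel {p. dimf p = n}))"

text \<open>Representatives of elements of the direct integral.\<close>
definition DI :: "mink measure \<Rightarrow> (mink \<Rightarrow> enat) \<Rightarrow> (mink \<Rightarrow> nat \<Rightarrow> complex) set" where
  "DI \<mu> dimf = {\<phi>. (\<forall>p. \<phi> p \<in> fib (dimf p)) \<and> weakly_borel dimf \<phi> \<and>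
                  (\<integral>\<^sup>+ p. ennreal (l2norm2 (\<phi> p)) \<partial>\<mu>) < \<infinity>}"

definition aeq :: "mink measure \<Rightarrow> (mink \<Rightarrow> nat \<Rightarrow> complex) \<Rightarrow> (mink \<Rightarrow> nat \<Rightarrow> complex) \<Rightarrow> bool" where
  "aeq \<mu> \<phi> \<psi> \<longleftrightarrow> (AE p in \<mu>. \<phi> p = \<psi> p)"

definition di_inner :: "mink measure \<Rightarrow> (mink \<Rightarrow> nat \<Rightarrow> complex) \<Rightarrow> (mink \<Rightarrow> nat \<Rightarrow> complex) \<Rightarrow> complex" where
  "di_inner \<mu> \<phi> \<psi> = (\<integral>p. l2inner (\<phi> p) (\<psi> p) \<partial>\<mu>)"

definition Uop :: "mink \<Rightarrow> (mink \<Rightarrow> nat \<Rightarrow> complex) \<Rightarrow> mink \<Rightarrow> nat \<Rightarrow> complex" where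
  "Uop a \<phi> = (\<lambda>p k. exp (\<i> * complex_of_real (lor a p)) * \<phi> p k)"

text \<open>D is a dense linear subspace of the direct integral (a set of
  equivalence classes, hence closed under a.e. equality); each Phi(f) is a
  well-defined linear operator D -> H; the matrix elements are tempered
  distributions in f.\<close>
definition is_field ::
  "mink measure \<Rightarrow> (mink \<Rightarrow> enat) \<Rightarrow> (mink \<Rightarrow> nat \<Rightarrow> complex) set \<Rightarrow>
   ((mink \<Rightarrow> complex) \<Rightarrow> (mink \<Rightarrow> nat \<Rightarrow> complex) \<Rightarrow> (mink \<Rightarrow> nat \<Rightarrow> complex)) \<Rightarrow> bool" where
  "is_field \<mu> dimf D \<Phi> \<longleftrightarrow>
     D \<subseteq> DI \<mu> dimf \<and>
     (\<lambda>p k. 0) \<in> D \<and>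
     (\<forall>\<phi>\<in>D. \<forall>\<psi>\<in>D. \<forall>a b. (\<lambda>p k. a * \<phi> p k + b * \<psi> p k) \<in> D) \<and>
     (\<forall>\<phi>\<in>D. \<forall>\<psi>\<in>DI \<mu> dimf. aeq \<mu> \<phi> \<psi> \<longrightarrow> \<psi> \<in> D) \<and>
     (\<forall>\<phi>\<in>DI \<mu> dimf. \<forall>e>0. \<exists>\<psi>\<in>D.
         (\<integral>\<^sup>+ p. ennreal (l2norm2 (\<lambda>k. \<phi> p k - \<psi> p k)) \<partial>\<mu>) < ennreal e) \<and>
     (\<forall>f. schwartz f \<longrightarrow>
        (\<forall>\<phi>\<in>D. \<Phi> f \<phi> \<in> DI \<mu> dimf) \<and>
        (\<forall>\<phi>\<in>D. \<forall>\<psi>\<in>D. aeq \<mu> \<phi> \<psi> \<longrightarrow> aeq \<mu> (\<Phi> f \<phi>) (\<Phi> f \<psi>)) \<and>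
        (\<forall>\<phi>\<in>D. \<forall>\<psi>\<in>D. \<forall>a b.
            aeq \<mu> (\<Phi> f (\<lambda>p k. a * \<phi> p k + b * \<psi> p k))
                  (\<lambda>p k. a * \<Phi> f \<phi> p k + b * \<Phi> f \<psi> p k))) \<and>
     (\<forall>\<phi>\<in>D. \<forall>\<psi>\<in>D. schwartz_lin_cont (\<lambda>f. di_inner \<mu> \<phi> (\<Phi> f \<psi>)))"

end

theory Submission
  imports Defs "HOL-Probability.Characteristic_Functions" "HOL-Probability.Sinc_Integral"
begin

text \<open>Fix \<open>\<psi> \<in> D\<close> and consider the tempered distribution \<open>T f = \<langle>\<psi>, \<Phi>(f)\<Omega>\<rangle>\<close>. Covariance and
  invariance of \<open>\<Omega>\<close> give \<open>T({a}f) = \<integral> exp(i a p) \<langle>\<psi>(p), (\<Phi>(f)\<Omega>)(p)\<rangle> d\<mu>(p)\<close>. A convolution \<open>g * f\<close> is a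
  limit in the Schwartz topology of finite combinations of translates of \<open>f\<close>, so
  \<open>\<Phi>(g * f)\<Omega> = FT(g) \<Phi>(f)\<Omega>\<close> weakly on \<open>D\<close>. Since \<open>g * f = f * g\<close> and \<open>D\<close> is dense, \<open>FT(g) \<Phi>(f)\<Omega> = FT(f) \<Phi>(g)\<Omega>\<close>
  almost everywhere. Taking for \<open>g\<close> a Gaussian, whose Fourier transform has no zeros,
  \<open>\<Gamma> = \<Phi>(g)\<Omega> / FT(g)\<close> works for all \<open>f\<close> simultaneously.\<close>

section \<open>Schwartz functions\<close>

text \<open>Matrix elements are continuous in f only for \<psi> in D, and each \<Phi>(f)\<Omega> is
  fixed only up to a null set that may depend on f. Hence every identity is first tested against D,
  and \<Gamma> must come from one test function rather than from a limit or a pointwise choice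
  involving all f. The product formula for the Fourier transform of a convolution does not enter.
  The factor FT(g) appears because \<langle>\<psi>(p), (\<Phi>(f)\<Omega>)(p)\<rangle> d\<mu>(p) is
  a finite complex measure on which translations of f act by phases; averaging the phases with
  weight g gives FT(g). Since \<mu> may fail to be sigma-finite, the integrals over y and p are not
  interchanged by Fubini: for a simple function \<pi> the inner integral is a finite sum, and
  dominated convergence carries out the limit. Continuity of the distribution then demands
  convergence in every Schwartz seminorm, which is the reason for the Lipschitz estimates with
  polynomial weights that are uniform in x. Division by the Gaussian's transform need not preserve
  square integrability, so \<Gamma> is only a measurable choice of fibre vectors, not an element of
  the direct integral.\<close>

lemma schwartz_continuous: "schwartz f \<Longrightarrow> continuous_on UNIV (pdiffs is f)"
  by (simp add: schwartz_def)

lemma pdiffs_measurable: "schwartz f \<Longrightarrow> pdiffs is f \<in> borel_measurable borel"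
  by (intro borel_measurable_continuous_onI schwartz_continuous)

lemma schwartz_measurable: "schwartz f \<Longrightarrow> f \<in> borel_measurable borel"
  using pdiffs_measurable[of f "[]"] by simp

lemma schwartz_has_vector_derivative:
  "schwartz f \<Longrightarrow> ((\<lambda>t. pdiffs is f (x + t *\<^sub>R axis i 1)) has_vector_derivative pdiff i (pdiffs is f) x) (at 0)"
  by (simp add: schwartz_def)

lemma schwartz_bounded:
  "schwartz f \<Longrightarrow> bounded (range (\<lambda>x. (1 + norm x) ^ m * norm (pdiffs is f x)))"
  by (simp add: schwartz_def)

lemma schwartz_boundE:
  assumes "schwartz f"
  obtains C where "0 \<le> C" "\<And>x. (1 + norm x) ^ m * cmod (pdiffs is f x) \<le> C"
proof -
  from schwartz_bounded[OF assms, of m "is"] obtain C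
    where C: "\<And>x. norm ((1 + norm x) ^ m * norm (pdiffs is f x)) \<le> C"
    unfolding bounded_iff by auto
  have "(1 + norm x) ^ m * cmod (pdiffs is f x) \<le> C" for x
    using C[of x] by simp
  moreover have "0 \<le> C" using C[of 0] norm_ge_zero order_trans by blast
  ultimately show ?thesis using that by blast
qed

text \<open>Adding the four constants gives one that serves all directions, as needed when a path
  changes direction from axis to axis.\<close>

lemma schwartz_pdiff_bound_uniform:
  assumes "schwartz f"
  obtains C where "0 \<le> C" "\<And>i x. (1 + norm x) ^ m * cmod (pdiff i (pdiffs is f) x) \<le> C"
proof -
  have "\<exists>C. 0 \<le> C \<and> (\<forall>x. (1 + norm x) ^ m * cmod (pdiff i (pdiffs is f) x) \<le> C)" for i
    using schwartz_boundE[OF assms, of m "i # is"] by (metis pdiffs.simps(2))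
  then obtain C where C: "\<And>i. 0 \<le> C i" "\<And>i x. (1 + norm x) ^ m * cmod (pdiff i (pdiffs is f) x) \<le> C i"
    by metis
  have "(1 + norm x) ^ m * cmod (pdiff i (pdiffs is f) x) \<le> (\<Sum>i\<in>UNIV. C i)" for i x
    using C(2)[of x i] member_le_sum[of i UNIV C] C(1) by fastforce
  then show ?thesis using that C(1) by (metis sum_nonneg)
qed

lemma pdiff_translate: "pdiff i (translate a f) = translate a (pdiff i f)"
  by (auto simp: pdiff_def translate_def fun_eq_iff algebra_simps)

lemma pdiffs_translate: "pdiffs is (translate a f) = translate a (pdiffs is f)"
  by (induction "is") (simp_all add: pdiff_translate)

text \<open>Peetre's inequality. It moves a polynomial weight from x to x - y at the price of a
  weight in y, which a rapidly decreasing factor in y can absorb.\<close>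

lemma peetre_power:
  fixes x y :: "'a::real_normed_vector"
  shows "(1 + norm x) ^ m \<le> (1 + norm (x - y)) ^ m * (1 + norm y) ^ m"
proof -
  have "norm x \<le> norm (x - y) + norm y" by norm
  moreover have "0 \<le> norm (x - y) * norm y" by simp
  moreover have "(1 + norm (x - y)) * (1 + norm y) = 1 + norm (x - y) + norm y + norm (x - y) * norm y"
    by (simp add: algebra_simps)
  ultimately have "1 + norm x \<le> (1 + norm (x - y)) * (1 + norm y)"
    by linarith
  then show ?thesis
    by (metis add_nonneg_nonneg norm_ge_zero power_mono power_mult_distrib zero_le_one)
qed

lemma schwartz_translate:
  assumes "schwartz f" shows "schwartz (translate a f)"
  unfolding schwartz_def pdiffs_translate pdiff_translate
proof (intro conjI allI)
  fix "is" i x and m :: nat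
  show "continuous_on UNIV (translate a (pdiffs is f))"
    unfolding translate_def
    by (intro continuous_on_compose2[OF schwartz_continuous[OF assms]] continuous_intros) auto
  show "((\<lambda>t. translate a (pdiffs is f) (x + t *\<^sub>R axis i 1)) has_vector_derivative
      translate a (pdiff i (pdiffs is f)) x) (at 0)"
    using schwartz_has_vector_derivative[OF assms, of "is" "x - a" i]
    by (simp add: translate_def algebra_simps)
  obtain C where C: "0 \<le> C" "\<And>x. (1 + norm x) ^ m * cmod (pdiffs is f x) \<le> C"
    using schwartz_boundE[OF assms] by metis
  have "norm ((1 + norm x) ^ m * norm (translate a (pdiffs is f) x)) \<le> C * (1 + norm a) ^ m" for x
  proof -
    have "(1 + norm x) ^ m * norm (pdiffs is f (x - a))
        \<le> (1 + norm (x - a)) ^ m * (1 + norm a) ^ m * norm (pdiffs is f (x - a))"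
      by (intro mult_right_mono peetre_power) simp
    also have "\<dots> \<le> C * (1 + norm a) ^ m"
      using mult_right_mono[OF C(2)[of "x - a"], of "(1 + norm a) ^ m"] by (simp add: mult_ac)
    finally show ?thesis by (simp add: translate_def)
  qed
  then show "bounded (range (\<lambda>x. (1 + norm x) ^ m * norm (translate a (pdiffs is f) x)))"
    unfolding bounded_iff by blast
qed

text \<open>\<open>vector_derivative\<close> is an arbitrary value where no derivative exists, so
  linearity of \<open>pdiff\<close> is not formal: it rests on the differentiability that
  \<open>schwartz\<close> records for every iterated derivative.\<close>

lemma pdiffs_linear:
  assumes "schwartz f" "schwartz g"
  shows "pdiffs is (\<lambda>x. a * f x + b * g x) = (\<lambda>x. a * pdiffs is f x + b * pdiffs is g x)"
proof (induction "is")
  case (Cons i "is")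
  show ?case
    unfolding pdiffs.simps Cons pdiff_def[of i "\<lambda>x. a * _ x + b * _ x"]
    by (intro ext vector_derivative_at has_vector_derivative_add has_vector_derivative_mult_right
        schwartz_has_vector_derivative assms)
qed simp

lemma schwartz_linear:
  assumes "schwartz f" "schwartz g"
  shows "schwartz (\<lambda>x. a * f x + b * g x)"
  unfolding schwartz_def
proof (intro conjI allI)
  fix "is" i x and m :: nat
  note L = pdiffs_linear[OF assms]
  show "continuous_on UNIV (pdiffs is (\<lambda>x. a * f x + b * g x))"
    unfolding L by (intro continuous_intros schwartz_continuous assms)
  have "pdiff i (pdiffs is (\<lambda>x. a * f x + b * g x)) x = a * pdiff i (pdiffs is f) x + b * pdiff i (pdiffs is g) x"
    using L[of "i # is"] by simp
  then show "((\<lambda>t. pdiffs is (\<lambda>x. a * f x + b * g x) (x + t *\<^sub>R axis i 1)) has_vector_derivative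
      pdiff i (pdiffs is (\<lambda>x. a * f x + b * g x)) x) (at 0)"
    unfolding L
    by (auto intro!: has_vector_derivative_add has_vector_derivative_mult_right
        schwartz_has_vector_derivative assms)
  obtain C where C: "0 \<le> C" "\<And>x. (1 + norm x) ^ m * cmod (pdiffs is f x) \<le> C"
    using schwartz_boundE[OF assms(1)] by metis
  obtain D where D: "0 \<le> D" "\<And>x. (1 + norm x) ^ m * cmod (pdiffs is g x) \<le> D"
    using schwartz_boundE[OF assms(2)] by metis
  have "norm ((1 + norm x) ^ m * norm (a * pdiffs is f x + b * pdiffs is g x)) \<le> cmod a * C + cmod b * D" for x
  proof -
    have "(1 + norm x) ^ m * norm (a * pdiffs is f x + b * pdiffs is g x)
       \<le> (1 + norm x) ^ m * (cmod a * norm (pdiffs is f x) + cmod b * norm (pdiffs is g x))"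
      by (intro mult_left_mono norm_triangle_le) (auto simp: norm_mult)
    also have "\<dots> \<le> cmod a * C + cmod b * D"
      using mult_left_mono[OF C(2)[of x], of "cmod a"] mult_left_mono[OF D(2)[of x], of "cmod b"]
      by (simp add: algebra_simps)
    finally show ?thesis by simp
  qed
  then show "bounded (range (\<lambda>x. (1 + norm x) ^ m * norm (pdiffs is (\<lambda>x. a * f x + b * g x) x)))"
    unfolding bounded_iff L by blast
qed

lemma schwartz_zero: "schwartz (\<lambda>x. 0)"
proof -
  have z: "pdiffs is (\<lambda>x. 0) = (\<lambda>x. 0)" for "is"
    by (induction "is") (auto simp: pdiff_def)
  have z': "pdiff i (\<lambda>x. 0) x = 0" for i x by (simp add: pdiff_def)
  show ?thesis unfolding schwartz_def z by (auto simp: image_constant_conv z')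
qed

lemma schwartz_sum_translate:
  assumes "finite V" "schwartz f"
  shows "schwartz (\<lambda>x. \<Sum>v\<in>V. c v * translate v f x)"
  using assms(1)
proof (induction V)
  case empty then show ?case by (simp add: schwartz_zero)
next
  case (insert v V)
  have "schwartz (\<lambda>x. c v * translate v f x + 1 * (\<Sum>v\<in>V. c v * translate v f x))"
    by (intro schwartz_linear schwartz_translate assms insert)
  then show ?case using insert by simp
qed

lemma lin_cont_sum_translate:
  assumes "finite V" "schwartz f" "schwartz_lin_cont T"
  shows "T (\<lambda>x. \<Sum>v\<in>V. c v * translate v f x) = (\<Sum>v\<in>V. c v * T (translate v f))"
  using assms(1)
proof (induction V)
  case empty
  have "T (\<lambda>x. 0 * (0::complex) + 0 * 0) = 0 * T (\<lambda>x. 0) + 0 * T (\<lambda>x. 0)"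
    using assms(3) schwartz_zero unfolding schwartz_lin_cont_def by blast
  then show ?case by simp
next
  case (insert v V)
  have "T (\<lambda>x. c v * translate v f x + 1 * (\<Sum>v\<in>V. c v * translate v f x)) =
      c v * T (translate v f) + 1 * T (\<lambda>x. \<Sum>v\<in>V. c v * translate v f x)"
    using assms(3) schwartz_translate[OF assms(2)] schwartz_sum_translate[OF insert(1) assms(2)]
    unfolding schwartz_lin_cont_def by blast
  then show ?case using insert by simp
qed

section \<open>Mean value estimates from derivatives along the axes\<close>

lemma partial_derivative_bound:
  fixes \<phi> :: "mink \<Rightarrow> complex"
  assumes d: "\<And>x. ((\<lambda>t. \<phi> (x + t *\<^sub>R axis i 1)) has_vector_derivative \<phi>' x) (at 0)"
    and B: "\<And>t. \<bar>t\<bar> \<le> \<bar>s\<bar> \<Longrightarrow> cmod (\<phi>' (x + t *\<^sub>R axis i 1)) \<le> B"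
  shows "cmod (\<phi> (x + s *\<^sub>R axis i 1) - \<phi> x) \<le> B * \<bar>s\<bar>"
proof -
  let ?e = "axis i 1 :: mink"
  \<comment> \<open>The hypothesis gives a derivative only at parameter 0, but at every base point.
    Moving the base point to \<open>x + r *\<^sub>R ?e\<close> yields the derivative at parameter
    r.\<close>
  have D: "((\<lambda>t. \<phi> (x + t *\<^sub>R ?e)) has_vector_derivative \<phi>' (x + r *\<^sub>R ?e)) (at r)" for r
  proof -
    have "((\<lambda>t. \<phi> (x + r *\<^sub>R ?e + t *\<^sub>R ?e)) has_vector_derivative \<phi>' (x + r *\<^sub>R ?e)) (at (r - r))"
      using d[of "x + r *\<^sub>R ?e"] by simp
    moreover have "((\<lambda>t. t - r) has_vector_derivative 1) (at r)"
      by (auto intro!: derivative_eq_intros simp: has_real_derivative_iff_has_vector_derivative[symmetric])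
    ultimately have "((\<lambda>t. \<phi> (x + r *\<^sub>R ?e + (t - r) *\<^sub>R ?e)) has_vector_derivative \<phi>' (x + r *\<^sub>R ?e)) (at r)"
      using vector_diff_chain_at[of "\<lambda>t. t - r" 1 r "\<lambda>t. \<phi> (x + r *\<^sub>R ?e + t *\<^sub>R ?e)"] by (simp add: o_def)
    moreover have "x + r *\<^sub>R ?e + (t - r) *\<^sub>R ?e = x + t *\<^sub>R ?e" for t
      by (simp add: algebra_simps)
    ultimately show ?thesis by simp
  qed
  have "cmod (\<phi> (x + s *\<^sub>R ?e) - \<phi> (x + 0 *\<^sub>R ?e)) \<le> B * norm (s - 0)"
  proof (rule differentiable_bound[where S="closed_segment 0 s" and f="\<lambda>t. \<phi> (x + t *\<^sub>R ?e)"
         and f'="\<lambda>t h. h *\<^sub>R \<phi>' (x + t *\<^sub>R ?e)"])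
    fix t assume t: "t \<in> closed_segment 0 s"
    show "((\<lambda>t. \<phi> (x + t *\<^sub>R ?e)) has_derivative (\<lambda>h. h *\<^sub>R \<phi>' (x + t *\<^sub>R ?e))) (at t within closed_segment 0 s)"
      using D[of t] unfolding has_vector_derivative_def by (rule has_derivative_at_withinI)
    have "\<bar>t\<bar> \<le> \<bar>s\<bar>" using t by (auto simp: closed_segment_eq_real_ivl split: if_splits)
    then have "cmod (\<phi>' (x + t *\<^sub>R ?e)) \<le> B" by (rule B)
    then show "onorm (\<lambda>h. h *\<^sub>R \<phi>' (x + t *\<^sub>R ?e)) \<le> B"
      by (intro onorm_le) (simp add: mult.commute[of B] mult_left_mono)
  qed auto
  then show ?thesis by simp
qed

text \<open>Only axis derivatives are at hand, no total derivative, so the path from w runs along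
  coordinate segments, one more for each index added to K. Every point on it has distance at most
  \<Sum>\<bar>s i\<bar> from w, which is the radius on which B has to bound the derivatives.\<close>

lemma lipschitz_from_partials_step:
  fixes \<phi> :: "mink \<Rightarrow> complex" and s :: "4 \<Rightarrow> real"
  assumes d: "\<And>i x. ((\<lambda>t. \<phi> (x + t *\<^sub>R axis i 1)) has_vector_derivative \<phi>' i x) (at 0)"
    and B: "\<And>i z. norm (z - w) \<le> (\<Sum>i\<in>UNIV. \<bar>s i\<bar>) \<Longrightarrow> cmod (\<phi>' i z) \<le> B"
    and K: "finite K"
  shows "cmod (\<phi> (w + (\<Sum>i\<in>K. s i *\<^sub>R axis i 1)) - \<phi> w) \<le> B * (\<Sum>i\<in>K. \<bar>s i\<bar>)"
  using K
proof (induction K rule: finite_induct)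
  case empty
  show ?case by simp
next
  case (insert i K)
  define u :: mink where "u = (\<Sum>i\<in>K. s i *\<^sub>R axis i 1)"
  have u: "norm u \<le> (\<Sum>i\<in>K. \<bar>s i\<bar>)"
    unfolding u_def by (rule sum_norm_le) simp
  have "cmod (\<phi> (w + u + s i *\<^sub>R axis i 1) - \<phi> (w + u)) \<le> B * \<bar>s i\<bar>"
  proof (rule partial_derivative_bound[where \<phi>=\<phi> and \<phi>'="\<phi>' i"])
    show "((\<lambda>t. \<phi> (x + t *\<^sub>R axis i 1)) has_vector_derivative \<phi>' i x) (at 0)" for x by (rule d)
    fix t assume t: "\<bar>t\<bar> \<le> \<bar>s i\<bar>"
    have "norm (u + t *\<^sub>R axis i 1) \<le> norm u + norm (t *\<^sub>R axis i (1::real) :: mink)"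
      by (rule norm_triangle_ineq)
    also have "\<dots> \<le> (\<Sum>i\<in>K. \<bar>s i\<bar>) + \<bar>s i\<bar>" using u t by simp
    also have "\<dots> = (\<Sum>i\<in>insert i K. \<bar>s i\<bar>)" using insert by simp
    also have "\<dots> \<le> (\<Sum>i\<in>UNIV. \<bar>s i\<bar>)" by (rule sum_mono2) auto
    finally show "cmod (\<phi>' i (w + u + t *\<^sub>R axis i 1)) \<le> B" by (intro B) (simp add: add.assoc)
  qed
  then have "cmod (\<phi> (w + u + s i *\<^sub>R axis i 1) - \<phi> w) \<le> B * \<bar>s i\<bar> + B * (\<Sum>i\<in>K. \<bar>s i\<bar>)"
    using insert.IH norm_triangle_ineq[of "\<phi> (w + u + s i *\<^sub>R axis i 1) - \<phi> (w + u)" "\<phi> (w + u) - \<phi> w"]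
    unfolding u_def[symmetric] by simp
  moreover have "w + (\<Sum>i\<in>insert i K. s i *\<^sub>R axis i 1) = w + u + s i *\<^sub>R axis i 1"
    using insert by (simp add: u_def)
  moreover have "(\<Sum>i\<in>insert i K. \<bar>s i\<bar>) = \<bar>s i\<bar> + (\<Sum>i\<in>K. \<bar>s i\<bar>)"
    using insert by simp
  ultimately show ?case by (simp only: distrib_left)
qed

text \<open>The 4 is the number of coordinates: the l1 norm of v - w is at most 4 times its
  Euclidean norm. It enters both the length of the axis-parallel path and the radius on which
  derivatives must be controlled.\<close>

lemma lipschitz_from_partials:
  fixes \<phi> :: "mink \<Rightarrow> complex"
  assumes d: "\<And>i x. ((\<lambda>t. \<phi> (x + t *\<^sub>R axis i 1)) has_vector_derivative \<phi>' i x) (at 0)"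
    and B: "\<And>i z. norm (z - w) \<le> 4 * norm (v - w) \<Longrightarrow> cmod (\<phi>' i z) \<le> B"
  shows "cmod (\<phi> v - \<phi> w) \<le> 4 * B * norm (v - w)"
proof -
  define s where "s i = (v - w) $ i" for i
  have "(\<Sum>i\<in>UNIV. \<bar>s i\<bar>) \<le> (\<Sum>i\<in>(UNIV::4 set). norm (v - w))"
    unfolding s_def by (intro sum_mono component_le_norm_cart)
  then have s: "(\<Sum>i\<in>UNIV. \<bar>s i\<bar>) \<le> 4 * norm (v - w)" by simp
  have B0: "0 \<le> B" by (rule order_trans[OF norm_ge_zero B[of w undefined]]) simp
  have "cmod (\<phi> (w + (\<Sum>i\<in>UNIV. s i *\<^sub>R axis i 1)) - \<phi> w) \<le> B * (\<Sum>i\<in>(UNIV::4 set). \<bar>s i\<bar>)"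
    by (rule lipschitz_from_partials_step[where \<phi>=\<phi> and \<phi>'=\<phi>', OF d B]) (use s in auto)
  also have "\<dots> \<le> B * (4 * norm (v - w))"
    by (intro mult_left_mono s B0)
  also have "w + (\<Sum>i\<in>UNIV. s i *\<^sub>R axis i 1) = v"
    using basis_expansion[of "v - w"] by (simp add: s_def scalar_mult_eq_scaleR)
  finally show ?thesis by (simp add: mult_ac)
qed

section \<open>Integrals over Minkowski space\<close>

text \<open>\<open>lborel\<close> is the image of the product of one-dimensional Lebesgue measures
  under the coordinate map, so the product theorem for finitely many factors applies. It serves both
  the integrability of the polynomial weight and the factorisation of the Gaussian's
  transform.\<close>

lemma lborel_prod_Basis:
  fixes h :: "'a::euclidean_space \<Rightarrow> real \<Rightarrow> 'c::{real_normed_field,banach,second_countable_topology}"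
  assumes h: "\<And>b. b \<in> Basis \<Longrightarrow> integrable lborel (h b)"
  shows "integrable lborel (\<lambda>x::'a. \<Prod>b\<in>Basis. h b (x \<bullet> b))" (is ?I)
    and "(\<integral>x. (\<Prod>b\<in>Basis. h b (x \<bullet> b)) \<partial>lborel) = (\<Prod>b\<in>Basis. \<integral>t. h b t \<partial>lborel)" (is ?E)
proof -
  interpret product_sigma_finite "\<lambda>_::'a. lborel :: real measure" ..
  have [measurable]: "\<And>b. b \<in> Basis \<Longrightarrow> h b \<in> borel_measurable borel"
    using borel_measurable_integrable[OF h] by simp
  let ?T = "\<lambda>f. \<Sum>b\<in>Basis. f b *\<^sub>R b :: 'a"
  have T: "(\<lambda>f. \<Prod>b\<in>Basis. h b (?T f \<bullet> b)) = (\<lambda>f. \<Prod>b\<in>Basis. h b (f b))"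
    by (auto intro!: prod.cong)
  show ?I
    by (subst lborel_eq, subst integrable_distr_eq)
       (auto simp: T intro!: product_integrable_prod h)
  show ?E
    by (subst lborel_eq, subst integral_distr)
       (auto simp: T intro!: product_integral_prod h)
qed

lemma lborel_prod_cart:
  fixes h :: "'n::finite \<Rightarrow> real \<Rightarrow> 'c::{real_normed_field,banach,second_countable_topology}"
  assumes h: "\<And>i. integrable lborel (h i)"
  shows "integrable lborel (\<lambda>x::real^'n. \<Prod>i\<in>UNIV. h i (x $ i))"
    and "(\<integral>x. (\<Prod>i\<in>UNIV. h i (x $ i)) \<partial>(lborel :: (real^'n) measure)) = (\<Prod>i\<in>UNIV. \<integral>t. h i t \<partial>lborel)"
proof -
  let ?e = "\<lambda>i::'n. axis i (1::real)"
  have inj: "inj ?e" by (auto simp: inj_on_def axis_eq_axis)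
  have B: "Basis = range ?e" by (auto simp: Basis_vec_def)
  define H where "H b = h (inv ?e b)" for b
  have H: "H (?e i) = h i" for i by (simp add: H_def inv_f_f[OF inj])
  have "(\<Prod>b\<in>Basis. H b (x \<bullet> b)) = (\<Prod>i\<in>UNIV. h i (x $ i))" for x
    unfolding B by (subst prod.reindex[OF inj]) (simp add: H cart_eq_inner_axis)
  moreover have "(\<Prod>b\<in>Basis. \<integral>t. H b t \<partial>lborel) = (\<Prod>i\<in>UNIV. \<integral>t. h i t \<partial>lborel)"
    unfolding B by (subst prod.reindex[OF inj]) (simp add: H)
  moreover have "integrable lborel (H b)" if "b \<in> Basis" for b
    using h by (simp add: H_def)
  ultimately show "integrable lborel (\<lambda>x::real^'n. \<Prod>i\<in>UNIV. h i (x $ i))"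
    and "(\<integral>x. (\<Prod>i\<in>UNIV. h i (x $ i)) \<partial>(lborel :: (real^'n) measure)) = (\<Prod>i\<in>UNIV. \<integral>t. h i t \<partial>lborel)"
    using lborel_prod_Basis[of H] by simp_all
qed

lemma integrable_inverse_1_plus_square: "integrable lborel (\<lambda>x::real. 1 / (1 + x\<^sup>2))"
proof -
  have p: "integrable lborel (\<lambda>x. indicator {0<..} x *\<^sub>R (1 / (1 + x\<^sup>2)) :: real)"
    using integrable_I0i_1_div_plus_square
    by (simp add: interval_lebesgue_integral_0_infty set_integrable_def)
  then have n: "integrable lborel (\<lambda>x. indicator {0<..} (- x) *\<^sub>R (1 / (1 + (- x)\<^sup>2)) :: real)"
    using lborel_integrable_real_affine[OF p, of "-1" 0] by simp
  \<comment> \<open>The half-line function and its mirror image both miss the origin, hence equality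
    only almost everywhere.\<close>
  have "AE x in lborel. x \<noteq> (0::real)" by (rule AE_lborel_singleton)
  then have "AE x in lborel. indicator {0<..} x *\<^sub>R (1 / (1 + x\<^sup>2)) +
      indicator {0<..} (- x) *\<^sub>R (1 / (1 + (- x)\<^sup>2)) = (1 / (1 + x\<^sup>2) :: real)"
    by eventually_elim (auto split: split_indicator)
  then show ?thesis
    using Bochner_Integration.integrable_add[OF p n] by (subst (asm) integrable_cong_AE) auto
qed

text \<open>The exponent 8 is 2 times 4: each of the four factors 1 + (x $ i)^2 is at most (1 + norm
  x)^2, so comparison with their integrable product suffices and no polar coordinates are
  required.\<close>

lemma integrable_weight_decay: "integrable lborel (\<lambda>x::mink. 1 / (1 + norm x) ^ 8)"
proof (rule Bochner_Integration.integrable_bound)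
  show "integrable lborel (\<lambda>x::mink. \<Prod>i\<in>UNIV. 1 / (1 + (x $ i)\<^sup>2))"
    by (intro lborel_prod_cart integrable_inverse_1_plus_square)
  have "norm (1 / (1 + norm x) ^ 8) \<le> norm (\<Prod>i\<in>UNIV. 1 / (1 + (x $ i)\<^sup>2))" for x :: mink
  proof -
    have "1 + (x $ i)\<^sup>2 \<le> (1 + norm x)\<^sup>2" for i
      using component_le_norm_cart[of x i] power_mono[of "\<bar>x $ i\<bar>" "norm x" 2]
      by (simp add: power2_eq_square algebra_simps)
    then have "(\<Prod>i\<in>UNIV. 1 + (x $ i)\<^sup>2) \<le> (\<Prod>i\<in>(UNIV::4 set). (1 + norm x)\<^sup>2)"
      by (intro prod_mono) auto
    also have "\<dots> = (1 + norm x) ^ 8" by (simp flip: power_mult)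
    finally have "(\<Prod>i\<in>UNIV. 1 + (x $ i)\<^sup>2) \<le> (1 + norm x) ^ 8" .
    moreover have "0 < (\<Prod>i\<in>UNIV. 1 + (x $ i)\<^sup>2)" by (intro prod_pos) (simp add: add_pos_nonneg)
    ultimately have "1 / (1 + norm x) ^ 8 \<le> 1 / (\<Prod>i\<in>UNIV. 1 + (x $ i)\<^sup>2)"
      by (intro divide_left_mono mult_pos_pos zero_less_power) (auto simp: add_pos_nonneg)
    then show ?thesis by (simp add: prod_dividef prod_nonneg abs_prod abs_of_nonneg)
  qed
  then show "AE x in lborel. norm (1 / (1 + norm x) ^ 8) \<le> norm (\<Prod>i\<in>UNIV. 1 / (1 + ((x::mink) $ i)\<^sup>2))"
    by simp
qed simp

lemma schwartz_weight_integrable: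
  assumes g: "schwartz g"
  shows "integrable lborel (\<lambda>y. (1 + norm y) ^ m * cmod (g y))"
proof -
  note [measurable] = schwartz_measurable[OF g]
  \<comment> \<open>Eight powers beyond m are spent on the integrable weight.\<close>
  obtain C where C: "0 \<le> C" "\<And>x. (1 + norm x) ^ (m + 8) * cmod (pdiffs [] g x) \<le> C"
    using schwartz_boundE[OF g] by metis
  show ?thesis
  proof (rule Bochner_Integration.integrable_bound)
    show "integrable lborel (\<lambda>x::mink. C * (1 / (1 + norm x) ^ 8))"
      by (intro integrable_mult_right integrable_weight_decay)
    have "norm ((1 + norm x) ^ m * cmod (g x)) \<le> norm (C * (1 / (1 + norm x) ^ 8))" for x
      using C(2)[of x] C(1) zero_less_power[of "1 + norm x" 8]
      by (simp add: pos_le_divide_eq add_pos_nonneg power_add mult_ac)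
    then show "AE x in lborel. norm ((1 + norm x) ^ m * cmod (g x)) \<le> norm (C * (1 / (1 + norm x) ^ 8))"
      by simp
  qed measurable
qed

lemma schwartz_integrable: "schwartz g \<Longrightarrow> integrable lborel g"
  using schwartz_weight_integrable[of g 0]
  by (subst integrable_norm_iff[symmetric]) (auto dest: schwartz_measurable)

lemma schwartz_integrable_mult:
  assumes g: "schwartz g" and [measurable]: "k \<in> borel_measurable borel"
    and k: "\<And>y. cmod (k y) \<le> C"
  shows "integrable lborel (\<lambda>y. g y * k y)"
proof (rule Bochner_Integration.integrable_bound)
  note [measurable] = schwartz_measurable[OF g]
  show "integrable lborel (\<lambda>y. C * g y)" by (intro integrable_mult_right schwartz_integrable g)
  have "norm (g y * k y) \<le> norm (C * g y)" for y
    using mult_left_mono[OF order_trans[OF k[of y] abs_ge_self], of "norm (g y)"]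
    by (simp add: norm_mult mult.commute)
  then show "AE y in lborel. norm (g y * k y) \<le> norm (C * g y)" by simp
qed (use schwartz_measurable[OF g] in measurable)

text \<open>Turns the derivative into a limit of difference quotients, the form to which sequences
  and dominated convergence apply.\<close>

lemma has_vector_derivative_at_0_iff:
  fixes f :: "real \<Rightarrow> 'a::real_normed_vector"
  shows "(f has_vector_derivative D) (at 0) \<longleftrightarrow> ((\<lambda>t. (f t - f 0) /\<^sub>R t) \<longlongrightarrow> D) (at 0)"
proof -
  have "norm (f t - f 0 - t *\<^sub>R D) / norm t = norm ((f t - f 0) /\<^sub>R t - D)" if "t \<noteq> 0" for t
  proof -
    have "(f t - f 0) /\<^sub>R t - D = (f t - f 0 - t *\<^sub>R D) /\<^sub>R t" using that by (simp add: algebra_simps)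
    then show ?thesis by (simp add: divide_inverse mult.commute)
  qed
  then have "((\<lambda>t. norm (f t - f 0 - t *\<^sub>R D) / norm t) \<longlongrightarrow> 0) (at 0) \<longleftrightarrow>
      ((\<lambda>t. norm ((f t - f 0) /\<^sub>R t - D)) \<longlongrightarrow> 0) (at 0)"
    by (intro filterlim_cong) (auto simp: eventually_at_filter)
  then show ?thesis
    by (simp add: has_vector_derivative_def has_derivative_iff_norm bounded_linear_scaleR_left
        tendsto_norm_zero_iff LIM_zero_iff)
qed

section \<open>Convolution along a map\<close>

text \<open>For \<open>\<pi> = id\<close> this is the convolution \<open>g * f\<close>; for a simple function \<open>\<pi>\<close> it is a finite
  linear combination of translates of \<open>f\<close>. Approximating \<open>id\<close> by simple functions thus replaces
  Riemann sums.\<close>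
definition conv_along :: "(mink \<Rightarrow> mink) \<Rightarrow> (mink \<Rightarrow> complex) \<Rightarrow> (mink \<Rightarrow> complex) \<Rightarrow> mink \<Rightarrow> complex" where
  "conv_along \<pi> g f x = (\<integral>y. g y * f (x - \<pi> y) \<partial>lborel)"

lemma conv_along_continuous:
  assumes g: "schwartz g" and [measurable]: "\<pi> \<in> borel_measurable borel"
    and \<phi>: "continuous_on UNIV \<phi>" "\<And>x. cmod (\<phi> x) \<le> C"
  shows "continuous_on UNIV (conv_along \<pi> g \<phi>)"
proof -
  note [measurable] = schwartz_measurable[OF g] borel_measurable_continuous_onI[OF \<phi>(1)]
  have "(\<lambda>n. conv_along \<pi> g \<phi> (X n)) \<longlonglongrightarrow> conv_along \<pi> g \<phi> x" if X: "X \<longlonglongrightarrow> x" for X x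
    unfolding conv_along_def
  proof (rule integral_dominated_convergence[where w="\<lambda>y. cmod (g y) * C"])
    show "integrable lborel (\<lambda>y. cmod (g y) * C)"
      using schwartz_integrable[OF g] by simp
    have "(\<lambda>n. g y * \<phi> (X n - \<pi> y)) \<longlonglongrightarrow> g y * \<phi> (x - \<pi> y)" for y
      by (intro tendsto_mult tendsto_const tendsto_diff X
          continuous_on_tendsto_compose[OF \<phi>(1)]) auto
    then show "AE y in lborel. (\<lambda>n. g y * \<phi> (X n - \<pi> y)) \<longlonglongrightarrow> g y * \<phi> (x - \<pi> y)" by simp
    show "AE y in lborel. norm (g y * \<phi> (X n - \<pi> y)) \<le> cmod (g y) * C" for n
      by (simp add: norm_mult mult_left_mono \<phi>)
  qed measurable
  then show ?thesis
    unfolding continuous_on_sequentially by (auto simp: o_def)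
qed

text \<open>Differentiation under the integral sign along a sequence of increments. The mean value
  bound makes every difference quotient at most C' in norm, so C' times \<bar>g\<bar> dominates. The
  shift \<pi> y is independent of x; the derivative therefore falls on \<phi> alone, for any
  measurable \<pi>.\<close>

lemma conv_along_has_vector_derivative:
  assumes g: "schwartz g" and [measurable]: "\<pi> \<in> borel_measurable borel"
    and \<phi>: "continuous_on UNIV \<phi>" "\<And>x. cmod (\<phi> x) \<le> C"
    and \<phi>': "continuous_on UNIV \<phi>'" "\<And>x. cmod (\<phi>' x) \<le> C'"
    and d: "\<And>x. ((\<lambda>t. \<phi> (x + t *\<^sub>R axis i 1)) has_vector_derivative \<phi>' x) (at 0)"
  shows "((\<lambda>t. conv_along \<pi> g \<phi> (x + t *\<^sub>R axis i 1)) has_vector_derivative conv_along \<pi> g \<phi>' x) (at 0)"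
  unfolding has_vector_derivative_at_0_iff tendsto_at_iff_sequentially
proof (intro allI impI)
  note [measurable] = schwartz_measurable[OF g]
    borel_measurable_continuous_onI[OF \<phi>(1)] borel_measurable_continuous_onI[OF \<phi>'(1)]
  fix T :: "nat \<Rightarrow> real" assume T: "\<forall>n. T n \<in> UNIV - {0}" "T \<longlonglongrightarrow> 0"
  let ?e = "axis i 1 :: mink"
  let ?q = "\<lambda>t y. (\<phi> (x + t *\<^sub>R ?e - \<pi> y) - \<phi> (x - \<pi> y)) /\<^sub>R t"
  have q: "(conv_along \<pi> g \<phi> (x + t *\<^sub>R ?e) - conv_along \<pi> g \<phi> (x + 0 *\<^sub>R ?e)) /\<^sub>R t = (\<integral>y. g y * ?q t y \<partial>lborel)" for t
  proof -
    have "integrable lborel (\<lambda>y. g y * \<phi> (z - \<pi> y))" for z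
      by (rule schwartz_integrable_mult[OF g]) (use \<phi> in auto)
    then have "conv_along \<pi> g \<phi> (x + t *\<^sub>R ?e) - conv_along \<pi> g \<phi> x =
       (\<integral>y. g y * \<phi> (x + t *\<^sub>R ?e - \<pi> y) - g y * \<phi> (x - \<pi> y) \<partial>lborel)"
      unfolding conv_along_def by (subst Bochner_Integration.integral_diff) auto
    then show ?thesis
      by (simp add: algebra_simps flip: integral_scaleR_right)
  qed
  have "(\<lambda>n. \<integral>y. g y * ?q (T n) y \<partial>lborel) \<longlonglongrightarrow> (\<integral>y. g y * \<phi>' (x - \<pi> y) \<partial>lborel)"
  proof (rule integral_dominated_convergence[where w="\<lambda>y. cmod (g y) * C'"])
    show "integrable lborel (\<lambda>y. cmod (g y) * C')"
      using schwartz_integrable[OF g] by simp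
    have "(\<lambda>n. ?q (T n) y) \<longlonglongrightarrow> \<phi>' (x - \<pi> y)" for y
      using d[of "x - \<pi> y"] T unfolding has_vector_derivative_at_0_iff tendsto_at_iff_sequentially
      by (auto simp: o_def algebra_simps)
    then show "AE y in lborel. (\<lambda>n. g y * ?q (T n) y) \<longlonglongrightarrow> g y * \<phi>' (x - \<pi> y)"
      by (intro AE_I2 tendsto_mult tendsto_const)
    have q_le: "norm (?q t y) \<le> C'" if "t \<noteq> 0" for t y
      using partial_derivative_bound[where \<phi>=\<phi> and \<phi>'=\<phi>' and i=i and s=t and x="x - \<pi> y" and B=C'] d \<phi>' that
      by (simp add: inverse_eq_divide pos_divide_le_eq diff_add_eq)
    show "AE y in lborel. norm (g y * ?q (T n) y) \<le> cmod (g y) * C'" for n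
      unfolding norm_mult[of "g _"] by (intro AE_I2 mult_left_mono q_le) (use T in auto)
  qed measurable
  then show "((\<lambda>t. (conv_along \<pi> g \<phi> (x + t *\<^sub>R ?e) - conv_along \<pi> g \<phi> (x + 0 *\<^sub>R ?e)) /\<^sub>R t) \<circ> T)
      \<longlonglongrightarrow> conv_along \<pi> g \<phi>' x"
    by (simp only: q o_def) (simp add: conv_along_def)
qed

lemma schwartz_bounded_pdiffs:
  assumes "schwartz f" obtains C where "\<And>x. cmod (pdiffs is f x) \<le> C"
  using schwartz_boundE[OF assms, of 0 "is"] by auto

lemma conv_along_has_vector_derivative_pdiffs:
  assumes g: "schwartz g" and f: "schwartz f" and \<pi>: "\<pi> \<in> borel_measurable borel"
  shows "((\<lambda>t. conv_along \<pi> g (pdiffs is f) (x + t *\<^sub>R axis i 1)) has_vector_derivative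
     conv_along \<pi> g (pdiff i (pdiffs is f)) x) (at 0)"
proof -
  obtain C where "\<And>x. cmod (pdiffs is f x) \<le> C" using schwartz_bounded_pdiffs[OF f] by metis
  moreover obtain C' where "\<And>x. cmod (pdiffs (i # is) f x) \<le> C'" using schwartz_bounded_pdiffs[OF f] by metis
  ultimately show ?thesis
    using schwartz_continuous[OF f, of "is"] schwartz_continuous[OF f, of "i # is"]
    by (intro conv_along_has_vector_derivative[OF g \<pi>] schwartz_has_vector_derivative[OF f]) auto
qed

lemma pdiffs_conv_along:
  assumes "schwartz g" "schwartz f" "\<pi> \<in> borel_measurable borel"
  shows "pdiffs is (conv_along \<pi> g f) = conv_along \<pi> g (pdiffs is f)"
proof (induction "is")
  case (Cons i "is")
  show ?case
    unfolding pdiffs.simps Cons pdiff_def[of i "conv_along _ _ _"]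
    by (intro ext vector_derivative_at conv_along_has_vector_derivative_pdiffs assms)
qed simp

lemma schwartz_integral_bound:
  assumes g: "schwartz g" and [measurable]: "k \<in> borel_measurable borel"
    and k: "\<And>y. cmod (k y) \<le> (1 + norm y) ^ m * C"
  shows "integrable lborel (\<lambda>y. g y * k y)"
    and "cmod (\<integral>y. g y * k y \<partial>lborel) \<le> C * (\<integral>y. (1 + norm y) ^ m * cmod (g y) \<partial>lborel)"
proof -
  note [measurable] = schwartz_measurable[OF g]
  have I: "integrable lborel (\<lambda>y. (1 + norm y) ^ m * cmod (g y) * C)"
    by (intro integrable_mult_left schwartz_weight_integrable g)
  have le: "norm (g y * k y) \<le> (1 + norm y) ^ m * cmod (g y) * C" for y
    using mult_left_mono[OF k[of y], of "cmod (g y)"] by (simp add: norm_mult mult_ac)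
  show i: "integrable lborel (\<lambda>y. g y * k y)"
    by (rule Bochner_Integration.integrable_bound[OF I]) (use le in \<open>auto intro!: order_trans[OF le]\<close>)
  have "cmod (\<integral>y. g y * k y \<partial>lborel) \<le> (\<integral>y. norm (g y * k y) \<partial>lborel)" by simp
  also have "\<dots> \<le> (\<integral>y. (1 + norm y) ^ m * cmod (g y) * C \<partial>lborel)"
    by (intro integral_mono le integrable_norm i I)
  finally show "cmod (\<integral>y. g y * k y \<partial>lborel) \<le> C * (\<integral>y. (1 + norm y) ^ m * cmod (g y) \<partial>lborel)"
    by (simp add: mult.commute)
qed

text \<open>Peetre's inequality trades the weight in x for one in \<pi> y; since 1 + norm (\<pi> y)
  is at most 2 (1 + norm y), the decay of g absorbs it at the cost of 2^m. The factor 2 in the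
  growth condition is the one that the simple-function approximation of the identity
  provides.\<close>

lemma schwartz_conv_along:
  assumes g: "schwartz g" and f: "schwartz f" and [measurable]: "\<pi> \<in> borel_measurable borel"
    and \<pi>: "\<And>y. norm (\<pi> y) \<le> 2 * norm y"
  shows "schwartz (conv_along \<pi> g f)"
  unfolding schwartz_def
proof (intro conjI allI)
  note [measurable] = schwartz_measurable[OF g] pdiffs_measurable[OF f]
  fix "is" i x and m :: nat
  note pd = pdiffs_conv_along[OF g f, of \<pi>, simplified]
  obtain B where B: "\<And>x. cmod (pdiffs is f x) \<le> B" using schwartz_bounded_pdiffs[OF f] by metis
  show "continuous_on UNIV (pdiffs is (conv_along \<pi> g f))"
    unfolding pd by (rule conv_along_continuous[OF g _ schwartz_continuous[OF f] B]) measurable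
  have "pdiff i (conv_along \<pi> g (pdiffs is f)) = conv_along \<pi> g (pdiff i (pdiffs is f))"
    by (metis pd pdiffs.simps(2))
  then show "((\<lambda>t. pdiffs is (conv_along \<pi> g f) (x + t *\<^sub>R axis i 1)) has_vector_derivative
        pdiff i (pdiffs is (conv_along \<pi> g f)) x) (at 0)"
    unfolding pd using conv_along_has_vector_derivative_pdiffs[OF g f, of \<pi> "is" x i] by simp
  obtain C where C: "0 \<le> C" "\<And>x. (1 + norm x) ^ m * cmod (pdiffs is f x) \<le> C"
    using schwartz_boundE[OF f] by metis
  have "norm ((1 + norm x) ^ m * norm (conv_along \<pi> g (pdiffs is f) x))
      \<le> (2 ^ m * C) * (\<integral>y. (1 + norm y) ^ m * cmod (g y) \<partial>lborel)" for x
  proof -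
    define W where "W = (1 + norm x) ^ m"
    have W: "0 \<le> W" by (simp add: W_def)
    have "cmod (complex_of_real W * pdiffs is f (x - \<pi> y)) \<le> (1 + norm y) ^ m * (2 ^ m * C)" for y
    proof -
      have "W * cmod (pdiffs is f (x - \<pi> y)) \<le>
        ((1 + norm (x - \<pi> y)) ^ m * (1 + norm (\<pi> y)) ^ m) * cmod (pdiffs is f (x - \<pi> y))"
        unfolding W_def by (intro mult_right_mono peetre_power) simp
      also have "\<dots> \<le> C * (1 + norm (\<pi> y)) ^ m"
        using mult_right_mono[OF C(2)[of "x - \<pi> y"], of "(1 + norm (\<pi> y)) ^ m"] by (simp add: mult_ac)
      also have "\<dots> \<le> C * (2 * (1 + norm y)) ^ m"
        using \<pi>[of y] by (intro mult_left_mono power_mono C) auto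
      also have "\<dots> = (1 + norm y) ^ m * (2 ^ m * C)"
        unfolding power_mult_distrib by simp
      finally show ?thesis using W by (simp add: norm_mult)
    qed
    then have "cmod (\<integral>y. g y * (complex_of_real W * pdiffs is f (x - \<pi> y)) \<partial>lborel) \<le>
       (2 ^ m * C) * (\<integral>y. (1 + norm y) ^ m * cmod (g y) \<partial>lborel)"
      by (intro schwartz_integral_bound[OF g]) auto
    also have "(\<integral>y. g y * (complex_of_real W * pdiffs is f (x - \<pi> y)) \<partial>lborel) =
        complex_of_real W * conv_along \<pi> g (pdiffs is f) x"
      unfolding conv_along_def by (subst integral_mult_right_zero[symmetric]) (simp add: mult_ac)
    finally show ?thesis using W by (simp add: norm_mult flip: W_def)
  qed
  then show "bounded (range (\<lambda>x. (1 + norm x) ^ m * norm (pdiffs is (conv_along \<pi> g f) x)))"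
    unfolding bounded_iff pd by blast
qed

text \<open>The substitution of x - y for y preserves Lebesgue measure: the scaling factor of
  \<open>lborel_affine\<close> is a power of \<bar>-1\<bar>, hence 1.\<close>

lemma conv_along_commute:
  assumes [measurable]: "f \<in> borel_measurable borel" "g \<in> borel_measurable borel"
  shows "conv_along (\<lambda>y. y) g f = conv_along (\<lambda>y. y) f g"
proof
  fix x :: mink
  let ?h = "\<lambda>y. g y * f (x - y)"
  have "lborel = density (distr lborel borel (\<lambda>y. x + (-1) *\<^sub>R y)) (\<lambda>_. 1)"
    using lborel_affine[of "-1" x] by simp
  then have "(\<integral>y. ?h y \<partial>lborel) = (\<integral>y. ?h y \<partial>distr lborel borel (\<lambda>y. x + (-1) *\<^sub>R y))"
    by (simp add: density_1)
  also have "\<dots> = (\<integral>y. ?h (x + (-1) *\<^sub>R y) \<partial>lborel)"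
    by (rule integral_distr) measurable
  finally show "conv_along (\<lambda>y. y) g f x = conv_along (\<lambda>y. y) f g x"
    by (simp add: conv_along_def mult.commute)
qed

text \<open>A point z on the axis-parallel path between x - w and x - v satisfies norm (x - z) \<le>
  norm w + 4 norm (v - w). By Peetre's inequality the weight at x becomes the weight at z times a
  factor without x, and the former is absorbed by the decay of the derivative at z. The bound is
  therefore uniform in x.\<close>

lemma schwartz_weighted_lipschitz:
  assumes f: "schwartz f"
  obtains C where "0 \<le> C"
    "\<And>x v w. (1 + norm x) ^ m * cmod (pdiffs is f (x - v) - pdiffs is f (x - w))
       \<le> C * (1 + norm w + 4 * norm (v - w)) ^ m * norm (v - w)"
proof -
  obtain C where C: "0 \<le> C" "\<And>i x. (1 + norm x) ^ m * cmod (pdiff i (pdiffs is f) x) \<le> C"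
    using schwartz_pdiff_bound_uniform[OF f] by metis
  have "(1 + norm x) ^ m * cmod (pdiffs is f (x - v) - pdiffs is f (x - w))
       \<le> 4 * C * (1 + norm w + 4 * norm (v - w)) ^ m * norm (v - w)" for x v w
  proof -
    define R where "R = (1 + norm w + 4 * norm (v - w)) ^ m"
    have x: "0 < (1 + norm x) ^ m" by (simp add: add_pos_nonneg)
    have vw: "norm (x - v - (x - w)) = norm (v - w)"
      by (simp add: norm_minus_commute)
    have "cmod (pdiffs is f (x - v) - pdiffs is f (x - w)) \<le> 4 * (C * R / (1 + norm x) ^ m) * norm (x - v - (x - w))"
    proof (rule lipschitz_from_partials[where \<phi>'="\<lambda>i. pdiff i (pdiffs is f)", OF schwartz_has_vector_derivative[OF f]])
      fix i z assume z: "norm (z - (x - w)) \<le> 4 * norm (x - v - (x - w))"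
      have "x - z = w - (z - (x - w))" by simp
      then have "norm (x - z) \<le> norm w + norm (z - (x - w))" by (metis norm_triangle_ineq4)
      also have "\<dots> \<le> norm w + 4 * norm (v - w)" using z unfolding vw by simp
      finally have "(1 + norm (x - z)) ^ m \<le> R" unfolding R_def by (intro power_mono) auto
      then have "(1 + norm z) ^ m * (1 + norm (x - z)) ^ m \<le> (1 + norm z) ^ m * R"
        by (intro mult_left_mono) auto
      then have "(1 + norm x) ^ m \<le> (1 + norm z) ^ m * R"
        using peetre_power[of x m "x - z"] by simp
      then have "(1 + norm x) ^ m * cmod (pdiff i (pdiffs is f) z) \<le> (1 + norm z) ^ m * R * cmod (pdiff i (pdiffs is f) z)"
        by (rule mult_right_mono) simp
      also have "\<dots> \<le> C * R"
        using mult_right_mono[OF C(2)[of z i], of R] by (simp add: R_def mult_ac)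
      finally show "cmod (pdiff i (pdiffs is f) z) \<le> C * R / (1 + norm x) ^ m"
        using x by (simp add: pos_le_divide_eq mult.commute)
    qed
    then have "(1 + norm x) ^ m * cmod (pdiffs is f (x - v) - pdiffs is f (x - w))
        \<le> (1 + norm x) ^ m * (4 * (C * R / (1 + norm x) ^ m) * norm (v - w))"
      unfolding vw using x by (intro mult_left_mono) auto
    also have "\<dots> = 4 * C * R * norm (v - w)" using less_imp_neq[OF x] by (simp del: power_eq_0_iff)
    finally show ?thesis by (simp only: R_def)
  qed
  then show ?thesis using that[of "4 * C"] C(1) by simp
qed

text \<open>The weighted Lipschitz bound majorises the integrand of the difference by a function
  \<open>E n\<close> of y that no longer contains x, so its integral bounds the whole seminorm.
  \<open>E n\<close> tends to 0 pointwise and is dominated by a weight times \<bar>g\<bar>.\<close>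

lemma conv_along_tendsto:
  assumes g: "schwartz g" and f: "schwartz f"
    and m [measurable]: "\<And>n. \<pi> n \<in> borel_measurable borel"
    and \<pi>: "\<And>n y. norm (\<pi> n y) \<le> 2 * norm y"
    and lim: "\<And>y. (\<lambda>n. \<pi> n y) \<longlonglongrightarrow> y"
  shows "schwartz_tendsto (\<lambda>n. conv_along (\<pi> n) g f) (conv_along (\<lambda>y. y) g f)"
  unfolding schwartz_tendsto_def
proof (intro allI)
  note [measurable] = schwartz_measurable[OF g] pdiffs_measurable[OF f]
  fix m "is"
  let ?F = "\<lambda>n. conv_along (\<pi> n) g f" and ?G = "conv_along (\<lambda>y. y) g f" and ?\<phi> = "pdiffs is f"
  have F: "schwartz (?F n)" for n by (intro schwartz_conv_along g f m \<pi>)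
  have G: "schwartz ?G" by (intro schwartz_conv_along g f) auto
  have FG: "schwartz (\<lambda>x. ?F n x - ?G x)" for n
    using schwartz_linear[OF F[of n] G, where a=1 and b="-1"] by simp
  have pFG: "pdiffs is (\<lambda>x. ?F n x - ?G x) = (\<lambda>x. conv_along (\<pi> n) g ?\<phi> x - conv_along (\<lambda>y. y) g ?\<phi> x)" for n
    using pdiffs_linear[OF F[of n] G, where a=1 and b="-1"] by (simp add: pdiffs_conv_along g f)
  obtain C where C: "0 \<le> C" "\<And>x v w. (1 + norm x) ^ m * cmod (?\<phi> (x - v) - ?\<phi> (x - w))
       \<le> C * (1 + norm w + 4 * norm (v - w)) ^ m * norm (v - w)"
    using schwartz_weighted_lipschitz[OF f] by metis
  \<comment> \<open>13 = 1 + 4 * 3: with norm (\<pi> n y - y) \<le> 3 norm y, the base of the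
    Lipschitz weight is at most 13 (1 + norm y).\<close>
  define K where "K = C * 13 ^ m"
  have K: "0 \<le> K" using C(1) by (simp add: K_def)
  have diff: "norm (\<pi> n y - y) \<le> 3 * norm y" for n y
    using norm_triangle_ineq4[of "\<pi> n y" y] \<pi>[of n y] by simp
  have bd: "(1 + norm x) ^ m * cmod (?\<phi> (x - \<pi> n y) - ?\<phi> (x - y)) \<le> K * (1 + norm y) ^ m * norm (\<pi> n y - y)" for x n y
  proof -
    have "(1 + norm y + 4 * norm (\<pi> n y - y)) ^ m \<le> 13 ^ m * (1 + norm y) ^ m"
      unfolding power_mult_distrib[symmetric] using diff[of n y] by (intro power_mono) auto
    then have "C * (1 + norm y + 4 * norm (\<pi> n y - y)) ^ m * norm (\<pi> n y - y) \<le> C * (13 ^ m * (1 + norm y) ^ m) * norm (\<pi> n y - y)"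
      by (intro mult_right_mono mult_left_mono C) auto
    then show ?thesis using C(2)[of x "\<pi> n y" y] by (simp add: K_def mult_ac)
  qed
  define E where "E n y = cmod (g y) * (K * (1 + norm y) ^ m * norm (\<pi> n y - y))" for n y
  \<comment> \<open>The displacement norm (\<pi> n y - y) itself costs one further power of the
    weight, hence \<open>Suc m\<close>.\<close>
  have E_le: "norm (E n y) \<le> 3 * K * ((1 + norm y) ^ Suc m * cmod (g y))" for n y
  proof -
    define W where "W = 1 + norm y"
    have "norm (\<pi> n y - y) \<le> 3 * W" using diff[of n y] by (simp add: W_def)
    moreover have W: "0 \<le> W" by (simp add: W_def)
    ultimately have "cmod (g y) * (K * W ^ m * norm (\<pi> n y - y)) \<le> cmod (g y) * (K * W ^ m * (3 * W))"
      using K by (intro mult_left_mono) auto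
    then show ?thesis using K W by (simp add: E_def abs_mult mult_ac flip: W_def)
  qed
  have E_int: "integrable lborel (\<lambda>y. 3 * K * ((1 + norm y) ^ Suc m * cmod (g y)))"
    by (rule integrable_mult_right, rule schwartz_weight_integrable[OF g])
  have E_meas [measurable]: "E n \<in> borel_measurable borel" for n unfolding E_def by measurable
  have E_lim: "(\<lambda>n. \<integral>y. E n y \<partial>lborel) \<longlonglongrightarrow> (\<integral>y. 0 \<partial>(lborel :: mink measure))"
  proof (rule integral_dominated_convergence[where w="\<lambda>y. 3 * K * ((1 + norm y) ^ Suc m * cmod (g y))"])
    have "(\<lambda>n. E n y) \<longlonglongrightarrow> cmod (g y) * (K * (1 + norm y) ^ m * norm (y - y))" for y
      unfolding E_def by (intro tendsto_intros lim)
    then show "AE y in lborel. (\<lambda>n. E n y) \<longlonglongrightarrow> 0" by simp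
    show "AE y in lborel. norm (E n y) \<le> 3 * K * ((1 + norm y) ^ Suc m * cmod (g y))" for n
      by (intro AE_I2 E_le)
  qed (use E_int in simp_all)
  have E_integrable: "integrable lborel (E n)" for n
    proof (rule Bochner_Integration.integrable_bound[OF E_int])
    show "AE y in lborel. norm (E n y) \<le> norm (3 * K * ((1 + norm y) ^ Suc m * cmod (g y)))"
      using order_trans[OF E_le abs_ge_self] by (intro AE_I2) (simp only: real_norm_def)
  qed simp
  obtain B where B: "\<And>x. cmod (?\<phi> x) \<le> B" using schwartz_bounded_pdiffs[OF f] by metis
  have upper: "(1 + norm x) ^ m * norm (conv_along (\<pi> n) g ?\<phi> x - conv_along (\<lambda>y. y) g ?\<phi> x) \<le> (\<integral>y. E n y \<partial>lborel)" for n x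
  proof -
    have i1: "integrable lborel (\<lambda>y. g y * ?\<phi> (x - \<pi> n y))" and i2: "integrable lborel (\<lambda>y. g y * ?\<phi> (x - y))"
      by (auto intro!: schwartz_integrable_mult[OF g] B)
    have "(1 + norm x) ^ m * norm (conv_along (\<pi> n) g ?\<phi> x - conv_along (\<lambda>y. y) g ?\<phi> x) =
       (1 + norm x) ^ m * norm (\<integral>y. g y * ?\<phi> (x - \<pi> n y) - g y * ?\<phi> (x - y) \<partial>lborel)"
      unfolding conv_along_def using i1 i2 by simp
    also have "\<dots> \<le> (1 + norm x) ^ m * (\<integral>y. norm (g y * ?\<phi> (x - \<pi> n y) - g y * ?\<phi> (x - y)) \<partial>lborel)"
      by (intro mult_left_mono integral_norm_bound) auto
    also have "\<dots> = (\<integral>y. (1 + norm x) ^ m * norm (g y * ?\<phi> (x - \<pi> n y) - g y * ?\<phi> (x - y)) \<partial>lborel)"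
      by simp
    also have "\<dots> \<le> (\<integral>y. E n y \<partial>lborel)"
    proof (rule integral_mono)
      show "integrable lborel (\<lambda>y. (1 + norm x) ^ m * norm (g y * ?\<phi> (x - \<pi> n y) - g y * ?\<phi> (x - y)))"
        by (intro integrable_mult_right integrable_norm Bochner_Integration.integrable_diff i1 i2)
      fix y
      have "norm (g y * ?\<phi> (x - \<pi> n y) - g y * ?\<phi> (x - y)) = cmod (g y) * cmod (?\<phi> (x - \<pi> n y) - ?\<phi> (x - y))"
        by (simp add: norm_mult flip: right_diff_distrib)
      then show "(1 + norm x) ^ m * norm (g y * ?\<phi> (x - \<pi> n y) - g y * ?\<phi> (x - y)) \<le> E n y"
        using mult_left_mono[OF bd[of x n y], of "cmod (g y)"] by (simp add: E_def mult_ac)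
    qed (rule E_integrable)
    finally show ?thesis .
  qed
  show "(\<lambda>n. snorm m is (\<lambda>x. ?F n x - ?G x)) \<longlonglongrightarrow> 0"
  proof (rule tendsto_sandwich[OF _ _ tendsto_const])
    show "(\<lambda>n. \<integral>y. E n y \<partial>lborel) \<longlonglongrightarrow> 0" using E_lim by simp
    have "snorm m is (\<lambda>x. ?F n x - ?G x) \<le> (\<integral>y. E n y \<partial>lborel)" for n
      unfolding snorm_def pFG by (intro cSUP_least upper) auto
    then show "\<forall>\<^sub>F n in sequentially. snorm m is (\<lambda>x. ?F n x - ?G x) \<le> (\<integral>y. E n y \<partial>lborel)" by simp
    \<comment> \<open>\<open>snorm\<close> is a real supremum, so a lower bound through its value at
      0 requires boundedness above; this comes from the difference being a Schwartz
      function.\<close>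
    have "0 \<le> snorm m is (\<lambda>x. ?F n x - ?G x)" for n
      unfolding snorm_def
      by (rule cSUP_upper2[of _ _ 0]) (auto intro!: bounded_imp_bdd_above schwartz_bounded FG)
    then show "\<forall>\<^sub>F n in sequentially. 0 \<le> snorm m is (\<lambda>x. ?F n x - ?G x)" by simp
  qed
qed

text \<open>Splits the integral over the level sets of \<pi>. The coefficients do not involve k, so
  the same ones represent both the combination of translates of f and the combination of
  phases.\<close>

lemma integral_simple_function_compose:
  fixes g :: "'a \<Rightarrow> complex" and k :: "'b \<Rightarrow> complex"
  assumes g: "integrable M g" and \<pi>: "simple_function M \<pi>"
  shows "(\<integral>y. g y * k (\<pi> y) \<partial>M) = (\<Sum>v\<in>\<pi> ` space M. (\<integral>y. indicator (\<pi> -` {v} \<inter> space M) y *\<^sub>R g y \<partial>M) * k v)"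
proof -
  have s: "\<pi> -` {v} \<inter> space M \<in> sets M" if "v \<in> \<pi> ` space M" for v
    using \<pi> that by (auto simp: simple_function_def)
  have fin: "finite (\<pi> ` space M)" using \<pi> by (simp add: simple_function_def)
  have "(\<integral>y. g y * k (\<pi> y) \<partial>M) = (\<integral>y. (\<Sum>v\<in>\<pi> ` space M. indicator (\<pi> -` {v} \<inter> space M) y *\<^sub>R g y * k v) \<partial>M)"
  proof (rule Bochner_Integration.integral_cong[OF refl])
    fix y assume y: "y \<in> space M"
    have "(\<Sum>v\<in>\<pi> ` space M. indicator (\<pi> -` {v} \<inter> space M) y *\<^sub>R g y * k v)
        = (\<Sum>v\<in>\<pi> ` space M. if v = \<pi> y then g y * k v else 0)"
      using y by (intro sum.cong) (auto simp: indicator_def)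
    then show "g y * k (\<pi> y) = (\<Sum>v\<in>\<pi> ` space M. indicator (\<pi> -` {v} \<inter> space M) y *\<^sub>R g y * k v)"
      using y fin by simp
  qed
  also have "\<dots> = (\<Sum>v\<in>\<pi> ` space M. \<integral>y. indicator (\<pi> -` {v} \<inter> space M) y *\<^sub>R g y * k v \<partial>M)"
    by (intro Bochner_Integration.integral_sum integrable_mult_left integrable_mult_indicator s g)
  finally show ?thesis by (simp only: integral_mult_left_zero)
qed

section \<open>The Fourier transform and distributions evaluated on convolutions\<close>

lemma lor_commute: "lor x y = lor y x"
  by (simp add: lor_def mult.commute)

lemma continuous_on_lor [continuous_intros]:
  "continuous_on S f \<Longrightarrow> continuous_on S g \<Longrightarrow> continuous_on S (\<lambda>x. lor (f x) (g x))"
  unfolding lor_def by (intro continuous_intros)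

lemma borel_measurable_lor [measurable]:
  assumes "f \<in> borel_measurable M" "g \<in> borel_measurable M"
  shows "(\<lambda>x. lor (f x) (g x)) \<in> borel_measurable M"
proof -
  have "(\<lambda>z. lor (fst z) (snd z)) \<in> borel_measurable borel"
    by (intro borel_measurable_continuous_onI continuous_intros)
  from measurable_compose[OF borel_measurable_Pair[OF assms] this] show ?thesis by simp
qed

lemma borel_measurable_fourier [measurable]:
  assumes [measurable]: "g \<in> borel_measurable borel"
  shows "fourier g \<in> borel_measurable borel"
  unfolding fourier_def by measurable

lemma norm_fourier_le: "cmod (fourier g p) \<le> (\<integral>x. cmod (g x) \<partial>lborel)"
proof -
  have "cmod (fourier g p) \<le> (\<integral>x. norm (exp (\<i> * complex_of_real (lor p x)) * g x) \<partial>lborel)"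
    unfolding fourier_def by (rule integral_norm_bound)
  then show ?thesis by (simp add: norm_mult)
qed

text \<open>On translates of f, T is the Fourier transform of the finite complex measure h d\<mu>.
  Both sides are limits of T applied to \<open>conv_along (\<pi> n) g f\<close> for simple \<pi> n:
  the left by continuity of T, the right by dominated convergence after T has been evaluated on a
  finite sum.\<close>

lemma distribution_conv:
  assumes g: "schwartz g" and f: "schwartz f" and T: "schwartz_lin_cont T"
    and \<mu>: "sets \<mu> = sets borel" and h: "integrable \<mu> h"
    and Tf: "\<And>a. T (translate a f) = (\<integral>p. exp (\<i> * complex_of_real (lor a p)) * h p \<partial>\<mu>)"
  shows "T (conv_along (\<lambda>y. y) g f) = (\<integral>p. fourier g p * h p \<partial>\<mu>)"
proof -
  note [measurable] = schwartz_measurable[OF g]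
  have mu [simp, measurable_cong]: "sets \<mu> = sets borel" by (rule \<mu>)
  have h_meas [measurable]: "h \<in> borel_measurable borel"
    using borel_measurable_integrable[OF h] by (simp add: measurable_cong_sets[OF \<mu> refl])
  \<comment> \<open>Simple functions converging pointwise to the identity; the reference point 0 of
    the library result turns its distance bound into norm (\<pi> n y) \<le> 2 norm y.\<close>
  obtain \<pi> :: "nat \<Rightarrow> mink \<Rightarrow> mink" where \<pi>: "\<And>n. simple_function lborel (\<pi> n)" "\<And>y. (\<lambda>n. \<pi> n y) \<longlonglongrightarrow> y"
      "\<And>n y. norm (\<pi> n y) \<le> 2 * norm y"
    using borel_measurable_implies_sequence_metric[of "\<lambda>y. y" "lborel :: mink measure" 0] by auto
  have \<pi>_meas [measurable]: "\<pi> n \<in> borel_measurable borel" for n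
    using borel_measurable_simple_function[OF \<pi>(1)] by simp
  define c where "c n v = (\<integral>y. indicator (\<pi> n -` {v} \<inter> space lborel) y *\<^sub>R g y \<partial>lborel)" for n v
  have fin: "finite (range (\<pi> n))" for n using \<pi>(1)[of n] by (simp add: simple_function_def)
  have sums: "(\<integral>y. g y * k (\<pi> n y) \<partial>lborel) = (\<Sum>v\<in>range (\<pi> n). c n v * k v)" for n k
    using integral_simple_function_compose[OF schwartz_integrable[OF g] \<pi>(1)] by (simp add: c_def)
  define e where "e v p = exp (\<i> * complex_of_real (lor v p))" for v p
  have [measurable]: "(\<lambda>x. e (k x) (l x)) \<in> borel_measurable M"
    if [measurable]: "k \<in> borel_measurable M" "l \<in> borel_measurable M" for k l and M :: "mink measure"
    unfolding e_def by measurable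
  have norm_e [simp]: "cmod (e v p) = 1" for v p by (simp add: e_def)
  have eh: "integrable \<mu> (\<lambda>p. e v p * h p)" for v
    by (rule Bochner_Integration.integrable_bound[OF h]) (auto simp: norm_mult)
  have step: "T (conv_along (\<pi> n) g f) = (\<integral>p. (\<integral>y. g y * e (\<pi> n y) p \<partial>lborel) * h p \<partial>\<mu>)" for n
  proof -
    have "conv_along (\<pi> n) g f = (\<lambda>x. \<Sum>v\<in>range (\<pi> n). c n v * translate v f x)"
      unfolding conv_along_def translate_def by (rule ext) (rule sums)
    then have "T (conv_along (\<pi> n) g f) = (\<Sum>v\<in>range (\<pi> n). c n v * (\<integral>p. e v p * h p \<partial>\<mu>))"
      using lin_cont_sum_translate[OF fin f T] by (simp add: Tf e_def)
    also have "\<dots> = (\<integral>p. (\<Sum>v\<in>range (\<pi> n). c n v * (e v p * h p)) \<partial>\<mu>)"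
      using eh by simp
    also have "\<dots> = (\<integral>p. (\<integral>y. g y * e (\<pi> n y) p \<partial>lborel) * h p \<partial>\<mu>)"
    proof (rule Bochner_Integration.integral_cong[OF refl])
      fix p
      show "(\<Sum>v\<in>range (\<pi> n). c n v * (e v p * h p)) = (\<integral>y. g y * e (\<pi> n y) p \<partial>lborel) * h p"
        using sums[where n=n and k="\<lambda>v. e v p"] by (simp add: sum_distrib_right mult.assoc)
    qed
    finally show ?thesis .
  qed
  have "(\<lambda>n. T (conv_along (\<pi> n) g f)) \<longlonglongrightarrow> T (conv_along (\<lambda>y. y) g f)"
  proof -
    have seq: "(\<lambda>n. T (F n)) \<longlonglongrightarrow> T F'"
      if "\<And>n. schwartz (F n)" "schwartz F'" "schwartz_tendsto F F'" for F F'
      using T that unfolding schwartz_lin_cont_def by blast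
    show ?thesis
    proof (rule seq)
      show "schwartz (conv_along (\<pi> n) g f)" for n by (rule schwartz_conv_along[OF g f \<pi>_meas \<pi>(3)])
      show "schwartz (conv_along (\<lambda>y. y) g f)" by (rule schwartz_conv_along[OF g f]) simp_all
      show "schwartz_tendsto (\<lambda>n. conv_along (\<pi> n) g f) (conv_along (\<lambda>y. y) g f)"
        by (rule conv_along_tendsto[OF g f \<pi>_meas \<pi>(3,2)])
    qed
  qed
  \<comment> \<open>Two nested limits: for fixed p, the inner integrals converge under the bound
    \<bar>g\<bar>; their common bound, the L1 norm of g, times \<bar>h\<bar> then dominates over
    \<mu>.\<close>
  moreover have "(\<lambda>n. T (conv_along (\<pi> n) g f)) \<longlonglongrightarrow> (\<integral>p. fourier g p * h p \<partial>\<mu>)"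
    unfolding step
  proof (rule integral_dominated_convergence[where w="\<lambda>p. (\<integral>y. cmod (g y) \<partial>lborel) * cmod (h p)"])
    have lim: "(\<lambda>n. \<integral>y. g y * e (\<pi> n y) p \<partial>lborel) \<longlonglongrightarrow> fourier g p" for p
    proof -
      have "(\<lambda>n. \<integral>y. g y * e (\<pi> n y) p \<partial>lborel) \<longlonglongrightarrow> (\<integral>y. g y * e y p \<partial>lborel)"
      proof (rule integral_dominated_convergence[where w="\<lambda>y. cmod (g y)"])
        have "continuous_on UNIV (\<lambda>v. e v p)" unfolding e_def by (intro continuous_intros)
        then have "(\<lambda>n. g y * e (\<pi> n y) p) \<longlonglongrightarrow> g y * e y p" for y
          by (intro tendsto_mult tendsto_const continuous_on_tendsto_compose[OF _ \<pi>(2)]) auto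
        then show "AE y in lborel. (\<lambda>n. g y * e (\<pi> n y) p) \<longlonglongrightarrow> g y * e y p" by simp
      qed (use schwartz_integrable[OF g] in \<open>auto simp: norm_mult\<close>)
      then show ?thesis unfolding fourier_def e_def by (simp add: lor_commute[of p] mult.commute)
    qed
    then show "AE p in \<mu>. (\<lambda>n. (\<integral>y. g y * e (\<pi> n y) p \<partial>lborel) * h p) \<longlonglongrightarrow> fourier g p * h p"
      by (intro AE_I2 tendsto_mult tendsto_const)
    show "integrable \<mu> (\<lambda>p. (\<integral>y. cmod (g y) \<partial>lborel) * cmod (h p))"
      using h by simp
    have "cmod (\<integral>y. g y * e (\<pi> n y) p \<partial>lborel) \<le> (\<integral>y. cmod (g y) \<partial>lborel)" for n p
      using integral_norm_bound[of lborel "\<lambda>y. g y * e (\<pi> n y) p"] by (simp add: norm_mult)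
    then show "AE p in \<mu>. norm ((\<integral>y. g y * e (\<pi> n y) p \<partial>lborel) * h p) \<le> (\<integral>y. cmod (g y) \<partial>lborel) * cmod (h p)" for n
      unfolding norm_mult[of _ "h _"] by (intro AE_I2 mult_right_mono) auto
    \<comment> \<open>The inner integral is a finite sum of phases in p, so measurability needs no
      product measure with \<mu>.\<close>
    show "(\<lambda>p. (\<integral>y. g y * e (\<pi> n y) p \<partial>lborel) * h p) \<in> borel_measurable \<mu>" for n
      by (subst sums) measurable
  qed measurable
  ultimately show ?thesis by (rule LIMSEQ_unique)
qed

section \<open>The Gaussian\<close>

text \<open>The polynomial functions of the coordinates, generated by the operations that occur when
  P times the Gaussian is differentiated. Closure under axis derivatives and polynomial growth are
  all that is used of them.\<close>

inductive poly_fun :: "(mink \<Rightarrow> complex) \<Rightarrow> bool" where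
  const: "poly_fun (\<lambda>x. c)"
| coord: "poly_fun (\<lambda>x. complex_of_real (x $ i))"
| add: "poly_fun P \<Longrightarrow> poly_fun Q \<Longrightarrow> poly_fun (\<lambda>x. P x + Q x)"
| mult: "poly_fun P \<Longrightarrow> poly_fun Q \<Longrightarrow> poly_fun (\<lambda>x. P x * Q x)"

lemma poly_fun_continuous: "poly_fun P \<Longrightarrow> continuous_on UNIV P"
  by (induction rule: poly_fun.induct) (intro continuous_intros; assumption?)+

lemma poly_fun_bound:
  "poly_fun P \<Longrightarrow> \<exists>C N. 0 \<le> C \<and> (\<forall>x. cmod (P x) \<le> C * (1 + norm x) ^ N)"
proof (induction rule: poly_fun.induct)
  case (const c)
  show ?case by (rule exI[of _ "cmod c"], rule exI[of _ 0]) simp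
next
  case (coord i)
  have "cmod (complex_of_real (x $ i)) \<le> 1 * (1 + norm x) ^ 1" for x :: mink
    using component_le_norm_cart[of x i] by simp
  then show ?case using zero_le_one by blast
next
  case (add P Q)
  then obtain C N C' N' where P: "0 \<le> C" "\<And>x. cmod (P x) \<le> C * (1 + norm x) ^ N"
    and Q: "0 \<le> C'" "\<And>x. cmod (Q x) \<le> C' * (1 + norm x) ^ N'" by blast
  have "cmod (P x + Q x) \<le> (C + C') * (1 + norm x) ^ max N N'" for x
  proof -
    have "cmod (P x) + cmod (Q x) \<le> C * (1 + norm x) ^ max N N' + C' * (1 + norm x) ^ max N N'"
      using P Q by (intro add_mono order_trans[OF P(2)] order_trans[OF Q(2)] mult_left_mono power_increasing) auto
    then show ?thesis using norm_triangle_ineq[of "P x" "Q x"] by (simp add: distrib_right)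
  qed
  then show ?case using P(1) Q(1) add_nonneg_nonneg by blast
next
  case (mult P Q)
  then obtain C N C' N' where P: "0 \<le> C" "\<And>x. cmod (P x) \<le> C * (1 + norm x) ^ N"
    and Q: "0 \<le> C'" "\<And>x. cmod (Q x) \<le> C' * (1 + norm x) ^ N'" by blast
  have "cmod (P x * Q x) \<le> (C * C') * (1 + norm x) ^ (N + N')" for x
    using mult_mono[OF P(2)[of x] Q(2)[of x]] P(1) by (simp add: norm_mult power_add mult_ac)
  then show ?case using P(1) Q(1) mult_nonneg_nonneg by blast
qed

lemma has_vector_derivative_coord:
  "((\<lambda>t. complex_of_real ((x + t *\<^sub>R axis i 1) $ j)) has_vector_derivative complex_of_real (axis i 1 $ j)) (at 0)"
proof -
  have "((\<lambda>t. complex_of_real (x $ j) + t *\<^sub>R complex_of_real (axis i 1 $ j)) has_vector_derivative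
      0 + 1 *\<^sub>R complex_of_real (axis i 1 $ j)) (at 0)"
    by (auto intro!: derivative_eq_intros)
  then show ?thesis by (simp add: scaleR_conv_of_real[where 'a=complex])
qed

lemma poly_fun_has_vector_derivative:
  "poly_fun P \<Longrightarrow> \<exists>P'. poly_fun P' \<and>
     (\<forall>x. ((\<lambda>t. P (x + t *\<^sub>R axis i 1)) has_vector_derivative P' x) (at 0))"
proof (induction rule: poly_fun.induct)
  case (const c)
  show ?case by (rule exI[of _ "\<lambda>x. 0"]) (auto intro: poly_fun.const)
next
  case (coord j)
  show ?case
    by (rule exI[of _ "\<lambda>x. complex_of_real (axis i 1 $ j)"])
       (auto intro: poly_fun.const has_vector_derivative_coord simp del: vector_add_component)
next
  case (add P Q)
  then obtain P' Q' where *: "poly_fun P'" "poly_fun Q'"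
    "\<And>x. ((\<lambda>t. P (x + t *\<^sub>R axis i 1)) has_vector_derivative P' x) (at 0)"
    "\<And>x. ((\<lambda>t. Q (x + t *\<^sub>R axis i 1)) has_vector_derivative Q' x) (at 0)" by blast
  then show ?case
    by (intro exI[of _ "\<lambda>x. P' x + Q' x"]) (auto intro: poly_fun.add has_vector_derivative_add)
next
  case (mult P Q)
  then obtain P' Q' where *: "poly_fun P'" "poly_fun Q'"
    "\<And>x. ((\<lambda>t. P (x + t *\<^sub>R axis i 1)) has_vector_derivative P' x) (at 0)"
    "\<And>x. ((\<lambda>t. Q (x + t *\<^sub>R axis i 1)) has_vector_derivative Q' x) (at 0)" by blast
  have "((\<lambda>t. P (x + t *\<^sub>R axis i 1) * Q (x + t *\<^sub>R axis i 1)) has_vector_derivative P x * Q' x + P' x * Q x) (at 0)" for x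
    using has_vector_derivative_mult[OF *(3)[of x] *(4)[of x]] by simp
  then show ?case
    using * mult.hyps by (intro exI[of _ "\<lambda>x. P x * Q' x + P' x * Q x"]) (auto intro: poly_fun.add poly_fun.mult)
qed

text \<open>The exponent is the Euclidean square, not the Lorentz square, which would not give decay
  in all directions.\<close>

definition gaussian :: "mink \<Rightarrow> complex" where
  "gaussian x = complex_of_real (exp (- (x \<bullet> x) / 2))"

lemma gaussian_has_vector_derivative:
  "((\<lambda>t. gaussian (x + t *\<^sub>R axis i 1)) has_vector_derivative (- complex_of_real (x $ i)) * gaussian x) (at 0)"
proof -
  have e: "(x + t *\<^sub>R axis i 1) \<bullet> (x + t *\<^sub>R axis i 1) = x \<bullet> x + 2 * t * x $ i + t\<^sup>2" for t
    by (simp add: inner_add_left inner_add_right inner_commute[of "axis i 1"] power2_eq_square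
        flip: cart_eq_inner_axis) (simp add: inner_axis algebra_simps)
  have "((\<lambda>t. exp (- (x \<bullet> x + 2 * t * x $ i + t\<^sup>2) / 2)) has_real_derivative - (x $ i) * exp (- (x \<bullet> x) / 2)) (at 0)"
    by (auto intro!: derivative_eq_intros)
  then have "((\<lambda>t. complex_of_real (exp (- (x \<bullet> x + 2 * t * x $ i + t\<^sup>2) / 2))) has_vector_derivative
      complex_of_real (- (x $ i) * exp (- (x \<bullet> x) / 2))) (at 0)"
    by (intro has_vector_derivative_of_real) (simp add: has_real_derivative_iff_has_vector_derivative)
  then show ?thesis by (simp add: gaussian_def e)
qed

lemma pdiff_poly_gaussian:
  assumes P: "poly_fun P"
  obtains P' where "poly_fun P'"
    "\<And>x. ((\<lambda>t. P (x + t *\<^sub>R axis i 1) * gaussian (x + t *\<^sub>R axis i 1)) has_vector_derivative P' x * gaussian x) (at 0)"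
    "pdiff i (\<lambda>x. P x * gaussian x) = (\<lambda>x. P' x * gaussian x)"
proof -
  obtain P1 where P1: "poly_fun P1"
    "\<And>x. ((\<lambda>t. P (x + t *\<^sub>R axis i 1)) has_vector_derivative P1 x) (at 0)"
    using poly_fun_has_vector_derivative[OF P] by metis
  \<comment> \<open>The derivative of the Gaussian contributes - x $ i. The sign is written as
    multiplication by the constant -1, because the rules of \<open>poly_fun\<close> contain products
    but no negation.\<close>
  define P' where "P' x = P1 x + P x * (- 1 * complex_of_real (x $ i))" for x
  have d: "((\<lambda>t. P (x + t *\<^sub>R axis i 1) * gaussian (x + t *\<^sub>R axis i 1)) has_vector_derivative P' x * gaussian x) (at 0)" for x
    using has_vector_derivative_mult[OF P1(2)[of x] gaussian_has_vector_derivative[of x i]]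
    by (simp add: P'_def algebra_simps)
  moreover have "poly_fun P'"
    unfolding P'_def by (intro poly_fun.intros P P1)
  moreover have "pdiff i (\<lambda>x. P x * gaussian x) = (\<lambda>x. P' x * gaussian x)"
    unfolding pdiff_def by (intro ext vector_derivative_at d)
  ultimately show ?thesis using that by blast
qed

lemma pdiffs_gaussian: "\<exists>P. poly_fun P \<and> pdiffs is gaussian = (\<lambda>x. P x * gaussian x)"
proof (induction "is")
  case Nil
  show ?case by (rule exI[of _ "\<lambda>x. 1"]) (simp add: poly_fun.const)
next
  case (Cons i "is")
  then obtain P where P: "poly_fun P" "pdiffs is gaussian = (\<lambda>x. P x * gaussian x)" by blast
  then show ?case using pdiff_poly_gaussian[OF P(1), of i] by (metis pdiffs.simps(2))
qed

text \<open>A single term of the exponential series gives (1 + r)^k \<le> k! exp (1 + r), and 1 + r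
  - r^2/2 \<le> 3/2 is (r - 1)^2 \<ge> 0.\<close>

lemma gaussian_decay: "(1 + norm x) ^ k * cmod (gaussian x) \<le> fact k * exp (3 / 2)"
proof -
  define r where "r = norm x"
  have r: "0 \<le> r" "cmod (gaussian x) = exp (- r\<^sup>2 / 2)"
    by (simp_all add: r_def gaussian_def power2_norm_eq_inner)
  have "(\<Sum>n\<in>{k}. (1 + r) ^ n /\<^sub>R fact n) \<le> (\<Sum>n. (1 + r) ^ n /\<^sub>R fact n)"
    using r by (intro sum_le_suminf summable_exp_generic) auto
  then have "(1 + r) ^ k / fact k \<le> exp (1 + r)" by (simp add: exp_def divide_inverse mult.commute)
  then have "(1 + r) ^ k \<le> fact k * exp (1 + r)" by (simp add: field_simps)
  then have "(1 + r) ^ k * exp (- r\<^sup>2 / 2) \<le> fact k * exp (1 + r) * exp (- r\<^sup>2 / 2)" by simp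
  also have "\<dots> = fact k * exp (1 + r - r\<^sup>2 / 2)" by (simp add: mult_exp_exp)
  also have "1 + r - r\<^sup>2 / 2 \<le> 3 / 2" using zero_le_power2[of "r - 1"] by (simp add: power2_eq_square algebra_simps)
  finally show ?thesis by (simp add: r flip: r_def)
qed

lemma schwartz_gaussian: "schwartz gaussian"
  unfolding schwartz_def
proof (intro conjI allI)
  fix "is" i x and m :: nat
  obtain P where P: "poly_fun P" "pdiffs is gaussian = (\<lambda>x. P x * gaussian x)" using pdiffs_gaussian by blast
  have "continuous_on UNIV gaussian" unfolding gaussian_def by (intro continuous_intros) auto
  then show "continuous_on UNIV (pdiffs is gaussian)"
    unfolding P(2) by (intro continuous_on_mult poly_fun_continuous[OF P(1)])
  show "((\<lambda>t. pdiffs is gaussian (x + t *\<^sub>R axis i 1)) has_vector_derivative pdiff i (pdiffs is gaussian) x) (at 0)"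
    unfolding P(2) by (rule pdiff_poly_gaussian[OF P(1), of i]) simp
  obtain C N where C: "0 \<le> C" "\<And>x. cmod (P x) \<le> C * (1 + norm x) ^ N" using poly_fun_bound[OF P(1)] by blast
  have "norm ((1 + norm x) ^ m * cmod (P x * gaussian x)) \<le> C * (fact (m + N) * exp (3 / 2))" for x
  proof -
    have "(1 + norm x) ^ m * cmod (gaussian x) * cmod (P x) \<le> (1 + norm x) ^ m * cmod (gaussian x) * (C * (1 + norm x) ^ N)"
      by (intro mult_left_mono C) auto
    also have "\<dots> = C * ((1 + norm x) ^ (m + N) * cmod (gaussian x))" by (simp add: power_add mult_ac)
    also have "\<dots> \<le> C * (fact (m + N) * exp (3 / 2))" by (intro mult_left_mono gaussian_decay C)
    finally show ?thesis by (simp add: norm_mult mult_ac)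
  qed
  then show "bounded (range (\<lambda>x. (1 + norm x) ^ m * cmod (pdiffs is gaussian x)))"
    unfolding bounded_iff P(2) by blast
qed

text \<open>Up to the normalising factor, the integral is the characteristic function of the
  standard normal distribution, a real exponential and hence never 0.\<close>

lemma gaussian_char_nonzero:
  "(\<integral>t. exp (\<i> * complex_of_real (s * t)) * complex_of_real (exp (- t\<^sup>2 / 2)) \<partial>lborel) \<noteq> 0"
proof -
  have "complex_of_real (exp (- (s\<^sup>2) / 2)) = char std_normal_distribution s"
    by (simp add: char_std_normal_distribution)
  also have "\<dots> = (\<integral>t. std_normal_density t *\<^sub>R exp (\<i> * complex_of_real (s * t)) \<partial>lborel)"
    unfolding char_def by (subst integral_density) auto
  also have "\<dots> = complex_of_real (1 / sqrt (2 * pi)) *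
      (\<integral>t. exp (\<i> * complex_of_real (s * t)) * complex_of_real (exp (- t\<^sup>2 / 2)) \<partial>lborel)"
    by (subst integral_mult_right_zero[symmetric])
       (simp add: std_normal_density_def scaleR_conv_of_real mult_ac)
  finally show ?thesis by (auto simp del: of_real_exp)
qed

lemma fourier_gaussian_nonzero: "fourier gaussian p \<noteq> 0"
proof -
  \<comment> \<open>The Lorentz pairing becomes a Euclidean one after the time component of p
    changes sign.\<close>
  define s where "s i = (if i = 1 then - p $ i else p $ i)" for i :: 4
  define h where "h i t = exp (\<i> * complex_of_real (s i * t)) * complex_of_real (exp (- t\<^sup>2 / 2))" for i t
  have nz: "(\<integral>t. h i t \<partial>lborel) \<noteq> 0" for i
    unfolding h_def by (rule gaussian_char_nonzero)
  \<comment> \<open>A Bochner integral is 0 by convention when the integrand is not integrable, so a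
    nonzero value already proves integrability.\<close>
  then have I: "integrable lborel (h i)" for i
    using not_integrable_integral_eq by blast
  have "exp (\<i> * complex_of_real (lor p x)) * gaussian x = (\<Prod>i\<in>UNIV. h i (x $ i))" for x
  proof -
    have "lor p x = (\<Sum>i\<in>UNIV. s i * x $ i)" by (simp add: lor_def sum_4 s_def)
    moreover have "- (x \<bullet> x) / 2 = (\<Sum>i\<in>UNIV. - (x $ i)\<^sup>2 / 2)"
      by (simp add: inner_vec_def power2_eq_square sum_negf flip: sum_divide_distrib)
    ultimately show ?thesis
      by (simp add: h_def gaussian_def prod.distrib exp_sum sum_distrib_left flip: of_real_prod)
  qed
  then have "fourier gaussian p = (\<Prod>i\<in>UNIV. \<integral>t. h i t \<partial>lborel)"
    unfolding fourier_def using lborel_prod_cart(2)[of h, OF I] by simp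
  then show ?thesis using nz by simp
qed

section \<open>The direct integral\<close>

lemma fib_summable: "v \<in> fib n \<Longrightarrow> summable (\<lambda>k. (cmod (v k))\<^sup>2)"
  by (simp add: fib_def)

lemma fib_zero: "v \<in> fib n \<Longrightarrow> n \<le> enat k \<Longrightarrow> v k = 0"
  by (simp add: fib_def)

lemma norm_cnj_mult_le_squares: "cmod (cnj a * b) \<le> (cmod a)\<^sup>2 + (cmod b)\<^sup>2"
proof -
  have "0 \<le> cmod a * cmod b" by simp
  then have "cmod a * cmod b \<le> 2 * cmod a * cmod b" by linarith
  also have "\<dots> \<le> (cmod a)\<^sup>2 + (cmod b)\<^sup>2" by (rule sum_squares_bound)
  finally show ?thesis by (simp add: norm_mult)
qed

lemma l2inner_summable:
  assumes "v \<in> fib n" "w \<in> fib n'"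
  shows "summable (\<lambda>k. cmod (cnj (v k) * w k))"
proof (rule summable_comparison_test)
  show "summable (\<lambda>k. (cmod (v k))\<^sup>2 + (cmod (w k))\<^sup>2)"
    using assms by (intro summable_add fib_summable)
  show "\<exists>N. \<forall>k\<ge>N. norm (cmod (cnj (v k) * w k)) \<le> (cmod (v k))\<^sup>2 + (cmod (w k))\<^sup>2"
    by (intro exI allI impI) (simp only: real_norm_def abs_norm_cancel norm_cnj_mult_le_squares)
qed

lemma l2inner_sums:
  assumes "v \<in> fib n" "w \<in> fib n'"
  shows "(\<lambda>k. cnj (v k) * w k) sums l2inner v w"
  unfolding l2inner_def by (intro summable_sums summable_norm_cancel[OF l2inner_summable[OF assms]])

text \<open>A crude substitute for Cauchy-Schwarz. Its right side is a sum of integrable functions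
  on the direct integral, which is what integrability of the inner product requires.\<close>

lemma norm_l2inner_le:
  assumes "v \<in> fib n" "w \<in> fib n'"
  shows "cmod (l2inner v w) \<le> l2norm2 v + l2norm2 w"
proof -
  have "cmod (l2inner v w) \<le> (\<Sum>k. cmod (cnj (v k) * w k))"
    unfolding l2inner_def by (rule summable_norm[OF l2inner_summable[OF assms]])
  also have "\<dots> \<le> (\<Sum>k. (cmod (v k))\<^sup>2 + (cmod (w k))\<^sup>2)"
  proof (rule suminf_le)
    show "cmod (cnj (v k) * w k) \<le> (cmod (v k))\<^sup>2 + (cmod (w k))\<^sup>2" for k
      by (rule norm_cnj_mult_le_squares)
  qed (use assms in \<open>auto intro!: l2inner_summable summable_add fib_summable\<close>)
  also have "\<dots> = l2norm2 v + l2norm2 w"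
    unfolding l2norm2_def using assms by (intro suminf_add[symmetric] fib_summable)
  finally show ?thesis .
qed

lemma l2norm2_nonneg: "v \<in> fib n \<Longrightarrow> 0 \<le> l2norm2 v"
  unfolding l2norm2_def by (intro suminf_nonneg fib_summable) auto

lemma l2norm2_eq_0: "v \<in> fib n \<Longrightarrow> l2norm2 v = 0 \<Longrightarrow> v = (\<lambda>k. 0)"
  unfolding l2norm2_def using fib_summable suminf_eq_zero_iff[of "\<lambda>k. (cmod (v k))\<^sup>2"] by auto

lemma fib_cmult: "v \<in> fib n \<Longrightarrow> (\<lambda>k. c * v k) \<in> fib n"
  by (auto simp: fib_def norm_mult power_mult_distrib intro: summable_mult)

lemma fib_diff:
  assumes "v \<in> fib n" "w \<in> fib n" shows "(\<lambda>k. v k - w k) \<in> fib n"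
proof -
  have "summable (\<lambda>k. (cmod (v k - w k))\<^sup>2)"
  proof (rule summable_comparison_test)
    show "summable (\<lambda>k. 2 * (cmod (v k))\<^sup>2 + 2 * (cmod (w k))\<^sup>2)"
      using assms by (intro summable_add summable_mult fib_summable)
    have "(cmod (v k - w k))\<^sup>2 \<le> 2 * (cmod (v k))\<^sup>2 + 2 * (cmod (w k))\<^sup>2" for k
    proof -
      have "(cmod (v k - w k))\<^sup>2 \<le> (cmod (v k) + cmod (w k))\<^sup>2"
        by (intro power_mono norm_triangle_ineq4) simp
      also have "\<dots> \<le> 2 * (cmod (v k))\<^sup>2 + 2 * (cmod (w k))\<^sup>2"
        using zero_le_power2[of "cmod (v k) - cmod (w k)"] by (simp add: power2_diff power2_sum)
      finally show ?thesis .
    qed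
    then show "\<exists>N. \<forall>k\<ge>N. norm ((cmod (v k - w k))\<^sup>2) \<le> 2 * (cmod (v k))\<^sup>2 + 2 * (cmod (w k))\<^sup>2" by auto
  qed
  then show ?thesis using assms by (auto simp: fib_def)
qed

lemma l2inner_cmult_right:
  "v \<in> fib n \<Longrightarrow> w \<in> fib n' \<Longrightarrow> l2inner v (\<lambda>k. c * w k) = c * l2inner v w"
  using sums_mult[OF l2inner_sums, of v n w n' c]
  by (auto simp: l2inner_def mult_ac dest!: sums_unique[symmetric])

lemma l2norm2_cmult: "v \<in> fib n \<Longrightarrow> l2norm2 (\<lambda>k. c * v k) = (cmod c)\<^sup>2 * l2norm2 v"
  unfolding l2norm2_def by (simp add: norm_mult power_mult_distrib suminf_mult fib_summable)

lemma l2inner_diff_right: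
  assumes "v \<in> fib n" "w \<in> fib n'" "u \<in> fib n''"
  shows "l2inner v (\<lambda>k. w k - u k) = l2inner v w - l2inner v u"
  using sums_diff[OF l2inner_sums[OF assms(1,2)] l2inner_sums[OF assms(1,3)]]
  by (auto simp: l2inner_def right_diff_distrib dest!: sums_unique[symmetric])

lemma l2norm2_diff:
  assumes v: "v \<in> fib n" and w: "w \<in> fib n"
  shows "l2norm2 (\<lambda>k. v k - w k) = l2norm2 v + l2norm2 w - 2 * Re (l2inner w v)"
proof -
  have "(\<lambda>k. (cmod (v k))\<^sup>2 + (cmod (w k))\<^sup>2 - 2 * Re (cnj (w k) * v k)) sums (l2norm2 v + l2norm2 w - 2 * Re (l2inner w v))"
    unfolding l2norm2_def
    by (intro sums_diff sums_add sums_mult sums_Re l2inner_sums[OF w v] summable_sums fib_summable v w)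
       (use v w in \<open>auto intro: fib_summable\<close>)
  moreover have "(cmod (v k))\<^sup>2 + (cmod (w k))\<^sup>2 - 2 * Re (cnj (w k) * v k) = (cmod (v k - w k))\<^sup>2" for k
    by (simp add: cmod_power2 power2_diff)
  ultimately show ?thesis by (simp add: l2norm2_def[of "\<lambda>k. v k - w k"] sums_iff)
qed

text \<open>On the piece of dimension n, a component k < n is the inner product with the k-th unit
  vector, which lies in \<open>fib n\<close>; a component k \<ge> n vanishes. The pieces are
  countably many Borel sets, so weak measurability on each becomes ordinary measurability of scalar
  functions on all of space.\<close>

lemma weakly_borel_component:
  assumes dim: "\<forall>n. {p. dimf p = n} \<in> sets borel"
    and u: "weakly_borel dimf u" "\<And>p. u p \<in> fib (dimf p)"
  shows "(\<lambda>p. u p k) \<in> borel_measurable borel"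
proof (rule measurable_piecewise_restrict[of "range (\<lambda>n. {p. dimf p = n})"])
  show "countable (range (\<lambda>n. {p. dimf p = n}))" by (rule countableI_type[THEN countable_image])
  show "\<Omega> \<inter> space borel \<in> sets borel" if "\<Omega> \<in> range (\<lambda>n. {p. dimf p = n})" for \<Omega>
    using that dim by auto
  fix \<Omega> assume "\<Omega> \<in> range (\<lambda>n. {p. dimf p = n})"
  then obtain n where \<Omega>: "\<Omega> = {p. dimf p = n}" by auto
  show "(\<lambda>p. u p k) \<in> borel_measurable (restrict_space borel \<Omega>)"
  proof (cases "n \<le> enat k")
    case True
    have "(\<lambda>p. 0) \<in> borel_measurable (restrict_space borel \<Omega>)" by simp
    moreover have "u p k = 0" if "p \<in> space (restrict_space borel \<Omega>)" for p
      using fib_zero[OF u(2)[of p]] True that by (auto simp: \<Omega> space_restrict_space)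
    ultimately show ?thesis by (subst measurable_cong[where g="\<lambda>p. 0"]) auto
  next
    case False
    define b where "b j = (if j = k then 1 else 0 :: complex)" for j
    have "summable (\<lambda>j. (cmod (b j))\<^sup>2)" by (rule summable_finite[of "{k}"]) (auto simp: b_def)
    then have "b \<in> fib n" using False by (auto simp: fib_def b_def)
    then have "(\<lambda>p. l2inner b (u p)) \<in> borel_measurable (restrict_space borel \<Omega>)"
      using u(1) by (auto simp: weakly_borel_def \<Omega>)
    moreover have "l2inner b w = w k" for w
      unfolding l2inner_def by (subst suminf_finite[of "{k}"]) (auto simp: b_def)
    ultimately show ?thesis by simp
  qed
qed auto

lemma DI_D:
  assumes "\<phi> \<in> DI \<mu> dimf"
  shows "\<phi> p \<in> fib (dimf p)" "weakly_borel dimf \<phi>" "(\<integral>\<^sup>+ p. ennreal (l2norm2 (\<phi> p)) \<partial>\<mu>) < \<infinity>"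
  using assms by (auto simp: DI_def)

lemma borel_measurable_l2inner:
  assumes "\<And>k. (\<lambda>p. v p k) \<in> borel_measurable M" "\<And>k. (\<lambda>p. w p k) \<in> borel_measurable M"
  shows "(\<lambda>p. l2inner (v p) (w p)) \<in> borel_measurable M"
proof -
  have "cnj \<in> borel_measurable borel"
    by (intro borel_measurable_continuous_onI continuous_intros)
  then show ?thesis
    unfolding l2inner_def
    by (intro borel_measurable_suminf borel_measurable_times measurable_compose[OF assms(1), of cnj] assms(2))
qed

lemma borel_measurable_l2norm2:
  assumes "\<And>k. (\<lambda>p. v p k) \<in> borel_measurable M"
  shows "(\<lambda>p. l2norm2 (v p)) \<in> borel_measurable M"
proof -
  note [measurable] = assms
  show ?thesis unfolding l2norm2_def by measurable
qed

lemma weakly_borelI: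
  assumes "\<And>k. (\<lambda>p. u p k) \<in> borel_measurable borel"
  shows "weakly_borel dimf u"
  unfolding weakly_borel_def
  by (auto intro!: measurable_restrict_space1 borel_measurable_l2inner assms)

context
  fixes \<mu> :: "mink measure" and dimf :: "mink \<Rightarrow> enat"
  assumes borel: "sets \<mu> = sets borel"
    and dim: "\<forall>n. {p. dimf p = n} \<in> sets borel"
begin

lemma DI_component:
  assumes "\<phi> \<in> DI \<mu> dimf" shows "(\<lambda>p. \<phi> p k) \<in> borel_measurable borel"
  using DI_D(1,2)[OF assms] by (intro weakly_borel_component[OF dim])

lemma DI_measurable:
  assumes "\<phi> \<in> DI \<mu> dimf" "\<psi> \<in> DI \<mu> dimf"
  shows "(\<lambda>p. l2inner (\<phi> p) (\<psi> p)) \<in> borel_measurable \<mu>"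
    and "(\<lambda>p. l2norm2 (\<phi> p)) \<in> borel_measurable \<mu>"
  unfolding measurable_cong_sets[OF borel refl]
  by (intro borel_measurable_l2inner borel_measurable_l2norm2 DI_component assms)+

lemma DI_norm_integrable:
  assumes "\<phi> \<in> DI \<mu> dimf" shows "integrable \<mu> (\<lambda>p. l2norm2 (\<phi> p))"
proof (rule integrableI_bounded)
  show "(\<lambda>p. l2norm2 (\<phi> p)) \<in> borel_measurable \<mu>" by (rule DI_measurable[OF assms assms])
  show "(\<integral>\<^sup>+ p. ennreal (norm (l2norm2 (\<phi> p))) \<partial>\<mu>) < \<infinity>"
    using DI_D(3)[OF assms] l2norm2_nonneg[OF DI_D(1)[OF assms]] by simp
qed

lemma DI_inner_integrable:
  assumes "\<phi> \<in> DI \<mu> dimf" "\<psi> \<in> DI \<mu> dimf"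
  shows "integrable \<mu> (\<lambda>p. l2inner (\<phi> p) (\<psi> p))"
proof (rule Bochner_Integration.integrable_bound)
  show "integrable \<mu> (\<lambda>p. l2norm2 (\<phi> p) + l2norm2 (\<psi> p))"
    by (intro Bochner_Integration.integrable_add DI_norm_integrable assms)
  show "AE p in \<mu>. norm (l2inner (\<phi> p) (\<psi> p)) \<le> norm (l2norm2 (\<phi> p) + l2norm2 (\<psi> p))"
    using norm_l2inner_le[OF DI_D(1)[OF assms(1)] DI_D(1)[OF assms(2)]]
    by (auto intro: order_trans[OF _ abs_ge_self])
qed (rule DI_measurable[OF assms])

text \<open>The factor depends on p: this is the action of bounded multiplication operators, applied
  to Fourier transforms of Schwartz functions, which the L1 norm bounds.\<close>

lemma DI_cmult:
  assumes \<phi>: "\<phi> \<in> DI \<mu> dimf" and c: "c \<in> borel_measurable borel" "\<And>p. cmod (c p) \<le> C"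
  shows "(\<lambda>p k. c p * \<phi> p k) \<in> DI \<mu> dimf"
proof -
  have m: "(\<lambda>p. c p * \<phi> p k) \<in> borel_measurable borel" for k
    by (intro borel_measurable_times c DI_component \<phi>)
  have f: "(\<lambda>k. c p * \<phi> p k) \<in> fib (dimf p)" for p
    by (rule fib_cmult[OF DI_D(1)[OF \<phi>]])
  have "integrable \<mu> (\<lambda>p. l2norm2 (\<lambda>k. c p * \<phi> p k))"
  proof (rule Bochner_Integration.integrable_bound)
    show "integrable \<mu> (\<lambda>p. C\<^sup>2 * l2norm2 (\<phi> p))" by (intro integrable_mult_right DI_norm_integrable \<phi>)
    show "(\<lambda>p. l2norm2 (\<lambda>k. c p * \<phi> p k)) \<in> borel_measurable \<mu>"
      unfolding measurable_cong_sets[OF borel refl] by (intro borel_measurable_l2norm2 m)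
    have "norm (l2norm2 (\<lambda>k. c p * \<phi> p k)) \<le> norm (C\<^sup>2 * l2norm2 (\<phi> p))" for p
      using l2norm2_nonneg[OF DI_D(1)[OF \<phi>], of p] c(2)[of p]
      by (auto simp: l2norm2_cmult[OF DI_D(1)[OF \<phi>]] abs_mult intro!: mult_right_mono power_mono)
    then show "AE p in \<mu>. norm (l2norm2 (\<lambda>k. c p * \<phi> p k)) \<le> norm (C\<^sup>2 * l2norm2 (\<phi> p))" by simp
  qed
  then have "(\<integral>\<^sup>+ p. ennreal (l2norm2 (\<lambda>k. c p * \<phi> p k)) \<partial>\<mu>) < \<infinity>"
    using l2norm2_nonneg[OF f] by (simp add: integrable_iff_bounded)
  then show ?thesis using f weakly_borelI[OF m] by (simp add: DI_def)
qed

lemma DI_diff: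
  assumes \<phi>: "\<phi> \<in> DI \<mu> dimf" and \<psi>: "\<psi> \<in> DI \<mu> dimf"
  shows "(\<lambda>p k. \<phi> p k - \<psi> p k) \<in> DI \<mu> dimf"
proof -
  have f: "(\<lambda>k. \<phi> p k - \<psi> p k) \<in> fib (dimf p)" for p by (rule fib_diff[OF DI_D(1)[OF \<phi>] DI_D(1)[OF \<psi>]])
  have "l2norm2 (\<lambda>k. \<phi> p k - \<psi> p k) = l2norm2 (\<phi> p) + l2norm2 (\<psi> p) - 2 * Re (l2inner (\<psi> p) (\<phi> p))" for p
    by (rule l2norm2_diff[OF DI_D(1)[OF \<phi>] DI_D(1)[OF \<psi>]])
  moreover have "integrable \<mu> (\<lambda>p. l2norm2 (\<phi> p) + l2norm2 (\<psi> p) - 2 * Re (l2inner (\<psi> p) (\<phi> p)))"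
    by (intro Bochner_Integration.integrable_add Bochner_Integration.integrable_diff integrable_mult_right
        integrable_Re DI_norm_integrable DI_inner_integrable \<phi> \<psi>)
  ultimately have "(\<integral>\<^sup>+ p. ennreal (l2norm2 (\<lambda>k. \<phi> p k - \<psi> p k)) \<partial>\<mu>) < \<infinity>"
    using l2norm2_nonneg[OF f] by (simp add: integrable_iff_bounded)
  moreover have "weakly_borel dimf (\<lambda>p k. \<phi> p k - \<psi> p k)"
    by (intro weakly_borelI borel_measurable_diff DI_component \<phi> \<psi>)
  ultimately show ?thesis using f by (simp add: DI_def)
qed

text \<open>For \<psi> in D the cross term vanishes, so the squared distance from \<xi> to \<psi> is
  the sum of the two squared norms and in particular bounds that of \<xi>. Density makes this
  distance as small as desired.\<close>

lemma DI_orthogonal_dense: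
  assumes \<xi>: "\<xi> \<in> DI \<mu> dimf" and D: "D \<subseteq> DI \<mu> dimf"
    and dense: "\<And>e. 0 < e \<Longrightarrow> \<exists>\<psi>\<in>D. (\<integral>\<^sup>+ p. ennreal (l2norm2 (\<lambda>k. \<xi> p k - \<psi> p k)) \<partial>\<mu>) < ennreal e"
    and orth: "\<And>\<psi>. \<psi> \<in> D \<Longrightarrow> di_inner \<mu> \<psi> \<xi> = 0"
  shows "AE p in \<mu>. \<xi> p = (\<lambda>k. 0)"
proof -
  have "(\<integral>p. l2norm2 (\<xi> p) \<partial>\<mu>) \<le> 0 + e" if e: "0 < e" for e
  proof -
    obtain \<psi> where \<psi>: "\<psi> \<in> D" "(\<integral>\<^sup>+ p. ennreal (l2norm2 (\<lambda>k. \<xi> p k - \<psi> p k)) \<partial>\<mu>) < ennreal e"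
      using dense[OF e] by blast
    have \<psi>': "\<psi> \<in> DI \<mu> dimf" using \<psi> D by blast
    have d: "(\<lambda>p k. \<xi> p k - \<psi> p k) \<in> DI \<mu> dimf" by (rule DI_diff[OF \<xi> \<psi>'])
    have "ennreal (\<integral>p. l2norm2 (\<lambda>k. \<xi> p k - \<psi> p k) \<partial>\<mu>) < ennreal e"
      using \<psi>(2) by (subst nn_integral_eq_integral[symmetric])
        (auto intro: DI_norm_integrable[OF d] l2norm2_nonneg[OF DI_D(1)[OF d]])
    then have lt: "(\<integral>p. l2norm2 (\<lambda>k. \<xi> p k - \<psi> p k) \<partial>\<mu>) \<le> e"
      using e by (simp add: ennreal_less_iff l2norm2_nonneg[OF DI_D(1)[OF d]])
    have eq: "l2norm2 (\<lambda>k. \<xi> p k - \<psi> p k) = l2norm2 (\<xi> p) + l2norm2 (\<psi> p) - 2 * Re (l2inner (\<psi> p) (\<xi> p))" for p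
      by (rule l2norm2_diff[OF DI_D(1)[OF \<xi>] DI_D(1)[OF \<psi>']])
    have "(\<integral>p. Re (l2inner (\<psi> p) (\<xi> p)) \<partial>\<mu>) = 0"
      using orth[OF \<psi>(1)] DI_inner_integrable[OF \<psi>' \<xi>] by (simp add: di_inner_def)
    then have "(\<integral>p. l2norm2 (\<lambda>k. \<xi> p k - \<psi> p k) \<partial>\<mu>) = (\<integral>p. l2norm2 (\<xi> p) \<partial>\<mu>) + (\<integral>p. l2norm2 (\<psi> p) \<partial>\<mu>)"
      unfolding eq using DI_norm_integrable[OF \<xi>] DI_norm_integrable[OF \<psi>'] DI_inner_integrable[OF \<psi>' \<xi>]
      by (simp del: integral_Re)
    moreover have "0 \<le> (\<integral>p. l2norm2 (\<psi> p) \<partial>\<mu>)"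
      by (intro Bochner_Integration.integral_nonneg l2norm2_nonneg[OF DI_D(1)[OF \<psi>']])
    ultimately show ?thesis using lt by simp
  qed
  then have "(\<integral>p. l2norm2 (\<xi> p) \<partial>\<mu>) \<le> 0" by (rule field_le_epsilon)
  moreover have "0 \<le> (\<integral>p. l2norm2 (\<xi> p) \<partial>\<mu>)"
    by (intro Bochner_Integration.integral_nonneg l2norm2_nonneg[OF DI_D(1)[OF \<xi>]])
  ultimately have "(\<integral>p. l2norm2 (\<xi> p) \<partial>\<mu>) = 0" by simp
  then have "AE p in \<mu>. l2norm2 (\<xi> p) = 0"
    using integral_nonneg_eq_0_iff_AE[OF DI_norm_integrable[OF \<xi>]] l2norm2_nonneg[OF DI_D(1)[OF \<xi>]] by simp
  then show ?thesis
    by eventually_elim (rule l2norm2_eq_0[OF DI_D(1)[OF \<xi>]])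
qed

end

section \<open>Covariance on the invariant vector, proportionality of the vectors \<Phi>(f)\<Omega>,
  and the choice of \<Gamma>\<close>

theorem theorem1:
  fixes \<mu> :: "mink measure"
    and dimf :: "mink \<Rightarrow> enat"
    and D :: "(mink \<Rightarrow> nat \<Rightarrow> complex) set"
    and \<Phi> :: "(mink \<Rightarrow> complex) \<Rightarrow> (mink \<Rightarrow> nat \<Rightarrow> complex) \<Rightarrow> (mink \<Rightarrow> nat \<Rightarrow> complex)"
    and \<Omega> :: "mink \<Rightarrow> nat \<Rightarrow> complex"
  assumes borel_meas: "sets \<mu> = sets borel"
    and dim_pos: "\<forall>p. 1 \<le> dimf p"
    and dim_borel: "\<forall>n. {p. dimf p = n} \<in> sets borel"
    and field: "is_field \<mu> dimf D \<Phi>"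
    and cov_dom: "\<forall>a. Uop a ` D = D"
    and cov: "\<forall>a f. schwartz f \<longrightarrow> (\<forall>\<phi>\<in>D.
               aeq \<mu> (Uop a (\<Phi> f (Uop (- a) \<phi>))) (\<Phi> (translate a f) \<phi>))"
    and vac_D: "\<Omega> \<in> D"
    and vac_inv: "\<forall>a. aeq \<mu> (Uop a \<Omega>) \<Omega>"
  shows "\<exists>\<Gamma> :: mink \<Rightarrow> nat \<Rightarrow> complex.
           (\<forall>p. \<Gamma> p \<in> fib (dimf p)) \<and> weakly_borel dimf \<Gamma> \<and>
           (\<forall>f. schwartz f \<longrightarrow>
              (AE p in \<mu>. \<Phi> f \<Omega> p = (\<lambda>k. fourier f p * \<Gamma> p k)))"
proof -
  note hyps = borel_meas dim_borel
  note F = field[unfolded is_field_def]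
  have D_DI: "D \<subseteq> DI \<mu> dimf"
    by (rule conjunct1[OF F])
  note F5 = F[THEN conjunct2, THEN conjunct2, THEN conjunct2, THEN conjunct2]
  have dense: "\<exists>\<psi>\<in>D. (\<integral>\<^sup>+ p. ennreal (l2norm2 (\<lambda>k. \<phi> p k - \<psi> p k)) \<partial>\<mu>) < ennreal e"
    if "\<phi> \<in> DI \<mu> dimf" "0 < e" for \<phi> e
    using F5[THEN conjunct1] that by simp
  note F6 = F5[THEN conjunct2, THEN conjunct1, rule_format]
  have \<Phi>_DI: "\<Phi> f \<phi> \<in> DI \<mu> dimf" if "schwartz f" "\<phi> \<in> D" for f \<phi>
    using F6[OF that(1), THEN conjunct1] that(2) by simp
  have \<Phi>_cong: "aeq \<mu> (\<Phi> f \<phi>) (\<Phi> f \<psi>)" if "schwartz f" "\<phi> \<in> D" "\<psi> \<in> D" "aeq \<mu> \<phi> \<psi>" for f \<phi> \<psi>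
    using F6[OF that(1), THEN conjunct2, THEN conjunct1] that by simp
  have \<Phi>_cont: "schwartz_lin_cont (\<lambda>f. di_inner \<mu> \<phi> (\<Phi> f \<psi>))" if "\<phi> \<in> D" "\<psi> \<in> D" for \<phi> \<psi>
    using F5[THEN conjunct2, THEN conjunct2] that by simp
  have \<Omega>_DI: "\<Phi> f \<Omega> \<in> DI \<mu> dimf" if "schwartz f" for f by (rule \<Phi>_DI[OF that vac_D])
  \<comment> \<open>Invariance of \<Omega> holds only almost everywhere, so U(-a)\<Omega> is
    replaced by \<Omega> inside \<Phi>(f) through the compatibility of \<Phi>(f) with a.e.
    equality.\<close>
  have covariant: "AE p in \<mu>. \<Phi> (translate a f) \<Omega> p = (\<lambda>k. exp (\<i> * complex_of_real (lor a p)) * \<Phi> f \<Omega> p k)"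
    if f: "schwartz f" for a f
  proof -
    have "Uop (- a) \<Omega> \<in> D" using cov_dom vac_D by blast
    then have "AE p in \<mu>. \<Phi> f (Uop (- a) \<Omega>) p = \<Phi> f \<Omega> p"
      using \<Phi>_cong[OF f _ vac_D] vac_inv by (auto simp: aeq_def)
    moreover have "AE p in \<mu>. Uop a (\<Phi> f (Uop (- a) \<Omega>)) p = \<Phi> (translate a f) \<Omega> p"
      using cov f vac_D by (auto simp: aeq_def)
    ultimately show ?thesis by eventually_elim (simp add: Uop_def fun_eq_iff)
  qed
  \<comment> \<open>\<open>distribution_conv\<close> applies with h(p) = \<langle>\<psi>(p),
    (\<Phi>(f)\<Omega>)(p)\<rangle>; covariance supplies the phases, and the inner product is linear
    in its second argument.\<close>
  have conv: "di_inner \<mu> \<psi> (\<Phi> (conv_along (\<lambda>y. y) g f) \<Omega>) = (\<integral>p. fourier g p * l2inner (\<psi> p) (\<Phi> f \<Omega> p) \<partial>\<mu>)"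
    if g: "schwartz g" and f: "schwartz f" and \<psi>: "\<psi> \<in> D" for f g \<psi>
  proof (rule distribution_conv[OF g f \<Phi>_cont[OF \<psi> vac_D] borel_meas])
    have \<psi>': "\<psi> \<in> DI \<mu> dimf" using \<psi> D_DI by blast
    show I: "integrable \<mu> (\<lambda>p. l2inner (\<psi> p) (\<Phi> f \<Omega> p))"
      by (rule DI_inner_integrable[OF hyps \<psi>' \<Omega>_DI[OF f]])
    fix a
    show "di_inner \<mu> \<psi> (\<Phi> (translate a f) \<Omega>) =
        (\<integral>p. exp (\<i> * complex_of_real (lor a p)) * l2inner (\<psi> p) (\<Phi> f \<Omega> p) \<partial>\<mu>)"
      unfolding di_inner_def
    proof (rule integral_cong_AE)
      show "(\<lambda>p. l2inner (\<psi> p) (\<Phi> (translate a f) \<Omega> p)) \<in> borel_measurable \<mu>"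
        by (rule DI_measurable[OF hyps \<psi>' \<Omega>_DI[OF schwartz_translate[OF f]]])
      have [measurable]: "(\<lambda>p. lor a p) \<in> borel_measurable \<mu>"
        unfolding measurable_cong_sets[OF borel_meas refl] by measurable
      note [measurable] = borel_measurable_integrable[OF I]
      show "(\<lambda>p. exp (\<i> * complex_of_real (lor a p)) * l2inner (\<psi> p) (\<Phi> f \<Omega> p)) \<in> borel_measurable \<mu>"
        by measurable
      show "AE p in \<mu>. l2inner (\<psi> p) (\<Phi> (translate a f) \<Omega> p) =
          exp (\<i> * complex_of_real (lor a p)) * l2inner (\<psi> p) (\<Phi> f \<Omega> p)"
        using covariant[OF f, of a]
        by eventually_elim (simp add: l2inner_cmult_right[OF DI_D(1)[OF \<psi>'] DI_D(1)[OF \<Omega>_DI[OF f]]])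
    qed
  qed
  have proportional: "AE p in \<mu>. (\<lambda>k. fourier g p * \<Phi> f \<Omega> p k) = (\<lambda>k. fourier f p * \<Phi> g \<Omega> p k)"
    if g: "schwartz g" and f: "schwartz f" for f g
  proof -
    define \<alpha> where "\<alpha> p k = fourier g p * \<Phi> f \<Omega> p k" for p k
    define \<beta> where "\<beta> p k = fourier f p * \<Phi> g \<Omega> p k" for p k
    have \<alpha>: "\<alpha> \<in> DI \<mu> dimf" unfolding \<alpha>_def[abs_def]
      by (rule DI_cmult[OF hyps \<Omega>_DI[OF f] borel_measurable_fourier[OF schwartz_measurable[OF g]] norm_fourier_le])
    have \<beta>: "\<beta> \<in> DI \<mu> dimf" unfolding \<beta>_def[abs_def]
      by (rule DI_cmult[OF hyps \<Omega>_DI[OF g] borel_measurable_fourier[OF schwartz_measurable[OF f]] norm_fourier_le])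
    \<comment> \<open>The difference is orthogonal to D because \<alpha> and \<beta> represent,
      against each \<psi>, the matrix elements of g * f and f * g, which are the same
      function.\<close>
    have "AE p in \<mu>. (\<lambda>k. \<alpha> p k - \<beta> p k) = (\<lambda>k. 0)"
    proof (rule DI_orthogonal_dense[OF hyps DI_diff[OF hyps \<alpha> \<beta>] D_DI])
      show "\<exists>\<psi>\<in>D. (\<integral>\<^sup>+ p. ennreal (l2norm2 (\<lambda>k. \<alpha> p k - \<beta> p k - \<psi> p k)) \<partial>\<mu>) < ennreal e" if "0 < e" for e
        by (rule dense[OF DI_diff[OF hyps \<alpha> \<beta>] that])
      fix \<psi> assume \<psi>: "\<psi> \<in> D"
      then have \<psi>': "\<psi> \<in> DI \<mu> dimf" using D_DI by blast
      have "l2inner (\<psi> p) (\<alpha> p) = fourier g p * l2inner (\<psi> p) (\<Phi> f \<Omega> p)" for p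
        unfolding \<alpha>_def by (rule l2inner_cmult_right[OF DI_D(1)[OF \<psi>'] DI_D(1)[OF \<Omega>_DI[OF f]]])
      then have "(\<integral>p. l2inner (\<psi> p) (\<alpha> p) \<partial>\<mu>) = di_inner \<mu> \<psi> (\<Phi> (conv_along (\<lambda>y. y) g f) \<Omega>)"
        by (simp add: conv[OF g f \<psi>])
      moreover have "l2inner (\<psi> p) (\<beta> p) = fourier f p * l2inner (\<psi> p) (\<Phi> g \<Omega> p)" for p
        unfolding \<beta>_def by (rule l2inner_cmult_right[OF DI_D(1)[OF \<psi>'] DI_D(1)[OF \<Omega>_DI[OF g]]])
      then have "(\<integral>p. l2inner (\<psi> p) (\<beta> p) \<partial>\<mu>) = di_inner \<mu> \<psi> (\<Phi> (conv_along (\<lambda>y. y) f g) \<Omega>)"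
        by (simp add: conv[OF f g \<psi>])
      moreover have "l2inner (\<psi> p) (\<lambda>k. \<alpha> p k - \<beta> p k) = l2inner (\<psi> p) (\<alpha> p) - l2inner (\<psi> p) (\<beta> p)" for p
        by (rule l2inner_diff_right[OF DI_D(1)[OF \<psi>'] DI_D(1)[OF \<alpha>] DI_D(1)[OF \<beta>]])
      ultimately show "di_inner \<mu> \<psi> (\<lambda>p k. \<alpha> p k - \<beta> p k) = 0"
        using DI_inner_integrable[OF hyps \<psi>' \<alpha>] DI_inner_integrable[OF hyps \<psi>' \<beta>]
          conv_along_commute[OF schwartz_measurable[OF f] schwartz_measurable[OF g]]
        unfolding di_inner_def by simp
    qed
    then show ?thesis by eventually_elim (simp add: \<alpha>_def \<beta>_def fun_eq_iff)
  qed
  \<comment> \<open>The inverse of the transform is unbounded, so \<open>DI_cmult\<close> does not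
    cover this product; membership in the fibres and measurability of the components are verified
    directly.\<close>
  define \<Gamma> where "\<Gamma> p k = inverse (fourier gaussian p) * \<Phi> gaussian \<Omega> p k" for p k
  note G = \<Omega>_DI[OF schwartz_gaussian]
  show ?thesis
  proof (intro exI[of _ \<Gamma>] conjI allI impI)
    show "\<Gamma> p \<in> fib (dimf p)" for p unfolding \<Gamma>_def by (rule fib_cmult[OF DI_D(1)[OF G]])
    show "weakly_borel dimf \<Gamma>"
      unfolding \<Gamma>_def
      by (intro weakly_borelI borel_measurable_times borel_measurable_inverse borel_measurable_fourier
          DI_component[OF hyps G] schwartz_measurable[OF schwartz_gaussian])
    fix f assume "schwartz f"
    from proportional[OF schwartz_gaussian this]
    show "AE p in \<mu>. \<Phi> f \<Omega> p = (\<lambda>k. fourier f p * \<Gamma> p k)"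
      by eventually_elim (simp add: \<Gamma>_def fun_eq_iff field_simps fourier_gaussian_nonzero)
  qed
qed

end
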